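(* Let $\mathcal{C}\subset\mathbb{C}^3$ be an irreducible, non-planar real algebraic space curve defined by two polynomials $f_1,f_2\in\mathbb{R}[x_1,x_2,x_3]$, all of whose points at infinity are of the form $(1:m_2:m_3:0)$, and let $B=\{(z,r_2(z),r_3(z))\in\mathbb{C}^3 : z\in\mathbb{C},\ |z|>M\}$ be an infinity branch of $\mathcal{C}$ associated with the infinity point $(1:m_2:m_3:0)$. Let $\tilde r_2(z),\tilde r_3(z)$ be obtained from $r_2(z),r_3(z)$ by removing all terms with negative exponent, and let $\widetilde{\mathcal{C}}$ be the algebraic space curve containing the branch $\widetilde B=\{(z,\tilde r_2(z),\tilde r_3(z))\in\mathbb{C}^3 : z\in\mathbb{C},\ |z|>\widetilde M\}$; equivalently, with $n=\deg(B)$, $\widetilde{\mathcal{C}}$ is the curve with polynomial parametrization $\widetilde{\mathcal{Q}}(t)=(t^n,\tilde r_2(t^n),\tilde r_3(t^n))\in\mathbb{C}[t]^3$. Then $\widetilde{\mathcal{C}}$ is an asymptote (g-asymptote) of $\mathcal{C}$ at $B$.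
   Context: A real algebraic curve here is a curve over $\mathbb{C}$ with infinitely many real points. The degree of an algebraic space curve is the number of its intersection points with a generic plane. $\mathbb{C}\ll t\gg=\bigcup_{n\ge1}\mathbb{C}((t^{1/n}))$ is the field of formal Puiseux series. Infinity branches. Let $\mathcal{C}\subset\mathbb{C}^3$ be an algebraic curve, and let $\varphi_2(t),\varphi_3(t)\in\mathbb{C}\ll t\gg$ be Puiseux series without terms of negative exponent, $\varphi_k(t)=m_k+\sum_{i\ge1}a_{i,k}t^{N_{i,k}/N_k}$ with $a_{i,k}\neq0$ and $0<N_{1,k}<N_{2,k}<\cdots$, where $N_k$ is the ramification index (least common denominator of the exponents) of $\varphi_k$. Suppose they converge near $t=0$ and that, with $r_k(z)=z\varphi_k(z^{-1})=m_kz+\sum_{i\ge1}a_{i,k}z^{1-N_{i,k}/N_k}$, the points $(z,r_2(z),r_3(z))$ lie on $\mathcal{C}$ for $|z|>M$. Put $N=\operatorname{lcm}(N_2,N_3)$. The conjugates of $(r_2,r_3)$ are the $N$ pairs $(r_{j,2},r_{j,3})$, $r_{j,k}(z)=m_kz+\sum_{i\ge1}a_{i,k}c_j^{N_{i,k}N/N_k}z^{1-N_{i,k}/N_k}$, where $c_1,\dots,c_N$ are the complex $N$-th roots of $1$. The infinity branch associated with the infinity point $(1:m_2:m_3:0)$ is $B=\bigcup_{j=1}^N L_j$, with leaves $L_j=\{(z,r_{j,2}(z),r_{j,3}(z)) : |z|>M\}$; it is denoted by one of its leaves. Degree of a branch. For $k=2,3$, write the terms with non-negative exponent of $r_k$ as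 $m_kz+a_{1,k}z^{1-n_{1,k}/n_k}+\cdots+a_{\ell_k,k}z^{1-n_{\ell_k,k}/n_k}$ with $0<n_{1,k}<\cdots<n_{\ell_k,k}\le n_k$ and $\gcd(n_k,n_{1,k},\dots,n_{\ell_k,k})=1$ (so $n_k=1$ if $\ell_k=0$). Then $\deg(B):=\operatorname{lcm}(n_2,n_3)$. Approaching curves. For $p\in\mathbb{C}^3$ and an algebraic curve $\overline{\mathcal{C}}\subset\mathbb{C}^3$, $d(p,\overline{\mathcal{C}})=\min\{d(p,q):q\in\overline{\mathcal{C}}\}$. An algebraic space curve $\overline{\mathcal{C}}$ (over $\mathbb{C}$) approaches $\mathcal{C}$ at its infinity branch $B$ if there is a leaf $\{(z,r_2(z),r_3(z)):|z|>M\}\subset B$ with $\lim_{z\to\infty}d((z,r_2(z),r_3(z)),\overline{\mathcal{C}})=0$. A curve of degree $d$ is perfect if it cannot be approached (at any of its infinity branches) by any curve of degree less than $d$. A g-asymptote (or simply asymptote) of $\mathcal{C}$ at $B$ is a perfect curve that approaches $\mathcal{C}$ at $B$. *)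

theory Defs
  imports
    "HOL-Analysis.Analysis"
    "HOL-Computational_Algebra.Computational_Algebra"
    "HOL-Library.Extended_Nat"
begin

section \<open>Algebraic curves in complex affine 3-space\<close>

type_synonym point3 = "complex \<times> complex \<times> complex"

text \<open>
  Polynomials in three (four) variables are elements of \<open>R[x1][x2][x3]\<close> (\<open>R[x1][x2][x3][x4]\<close>),
  so the outermost polynomial variable is the last coordinate.  The metric on \<^typ>\<open>point3\<close> is
  the usual Euclidean (Hermitian) one.
\<close>

type_synonym 'a poly3 = "'a poly poly poly"
type_synonym 'a poly4 = "'a poly poly poly poly"

fun eval3 :: "complex poly3 \<Rightarrow> point3 \<Rightarrow> complex" where
  "eval3 p (x, y, z) = poly (poly (poly p [:[:z:]:]) [:y:]) x"

definition eval4 :: "complex poly4 \<Rightarrow> complex \<Rightarrow> complex \<Rightarrow> complex \<Rightarrow> complex \<Rightarrow> complex" where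
  "eval4 F x y z w = poly (poly (poly (poly F [:[:[:w:]:]:]) [:[:z:]:]) [:y:]) x"

definition complex_poly3 :: "real poly3 \<Rightarrow> complex poly3" where
  "complex_poly3 = map_poly (map_poly (map_poly complex_of_real))"

definition zero_set :: "complex poly3 set \<Rightarrow> point3 set" where
  "zero_set G = {p. \<forall>g\<in>G. eval3 g p = 0}"

definition algebraic :: "point3 set \<Rightarrow> bool" where
  "algebraic V \<longleftrightarrow> (\<exists>G. V = zero_set G)"

definition zariski_closure :: "point3 set \<Rightarrow> point3 set" where
  "zariski_closure S = zero_set {g. \<forall>p\<in>S. eval3 g p = 0}"

definition irreducible_algebraic :: "point3 set \<Rightarrow> bool" where
  "irreducible_algebraic V \<longleftrightarrow> algebraic V \<and> V \<noteq> {} \<and>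
     (\<forall>V1 V2. algebraic V1 \<and> algebraic V2 \<and> V = V1 \<union> V2 \<longrightarrow> V = V1 \<or> V = V2)"

text \<open>Krull dimension (of a nonempty algebraic set; the empty set is assigned 0 here).\<close>

definition alg_dim :: "point3 set \<Rightarrow> enat" where
  "alg_dim V = Sup {enat n | n. \<exists>Z :: nat \<Rightarrow> point3 set.
     (\<forall>i\<le>n. irreducible_algebraic (Z i) \<and> Z i \<subseteq> V) \<and> (\<forall>i<n. Z i \<subset> Z (Suc i))}"

definition irreducible_curve :: "point3 set \<Rightarrow> bool" where
  "irreducible_curve C \<longleftrightarrow> irreducible_algebraic C \<and> alg_dim C = 1"

text \<open>A curve is an algebraic set all of whose irreducible components have dimension 1.\<close>

definition space_curve :: "point3 set \<Rightarrow> bool" where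
  "space_curve C \<longleftrightarrow>
     (\<exists>\<C>. finite \<C> \<and> \<C> \<noteq> {} \<and> (\<forall>D\<in>\<C>. irreducible_curve D) \<and> C = \<Union>\<C>)"

definition plane :: "complex \<Rightarrow> complex \<Rightarrow> complex \<Rightarrow> complex \<Rightarrow> point3 set" where
  "plane a b c e = {(x, y, z). a * x + b * y + c * z = e}"

definition planar :: "point3 set \<Rightarrow> bool" where
  "planar C \<longleftrightarrow> (\<exists>a b c e. (a, b, c) \<noteq> (0, 0, 0) \<and> C \<subseteq> plane a b c e)"

text \<open>
  ``Generic plane'': all planes whose coefficient vector avoids some proper Zariski closed
  subset (the zero set of a nonzero polynomial \<open>F\<close>).  The degree is determined uniquely
  because finitely many such sets have a common complement.
\<close>

definition has_degree :: "point3 set \<Rightarrow> nat \<Rightarrow> bool" where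
  "has_degree C d \<longleftrightarrow> (\<exists>F :: complex poly4. F \<noteq> 0 \<and>
     (\<forall>a b c e. (a, b, c) \<noteq> (0, 0, 0) \<and> eval4 F a b c e \<noteq> 0 \<longrightarrow>
        finite (C \<inter> plane a b c e) \<and> card (C \<inter> plane a b c e) = d))"

definition real_curve :: "point3 set \<Rightarrow> bool" where
  "real_curve C \<longleftrightarrow> space_curve C \<and>
     infinite {(x, y, z). (complex_of_real x, complex_of_real y, complex_of_real z) \<in> C}"

definition homogeneous4 :: "nat \<Rightarrow> complex poly4 \<Rightarrow> bool" where
  "homogeneous4 d F \<longleftrightarrow>
     (\<forall>i j k l. coeff (coeff (coeff (coeff F l) k) j) i \<noteq> 0 \<longrightarrow> i + j + k + l = d)"

text \<open>
  The projective closure in \<open>P^3\<close>, as the set of all homogeneous coordinate vectors of its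
  points; \<open>(x, y, z)\<close> is the point \<open>(x:y:z:1)\<close>.
\<close>

definition projective_closure :: "point3 set \<Rightarrow> (complex \<times> complex \<times> complex \<times> complex) set" where
  "projective_closure C = {(x, y, z, w). (x, y, z, w) \<noteq> (0, 0, 0, 0) \<and>
     (\<forall>d F. homogeneous4 d F \<and> (\<forall>(x', y', z')\<in>C. eval4 F x' y' z' 1 = 0) \<longrightarrow>
        eval4 F x y z w = 0)}"

definition points_at_infinity :: "point3 set \<Rightarrow> (complex \<times> complex \<times> complex \<times> complex) set" where
  "points_at_infinity C = {(x, y, z, w) \<in> projective_closure C. w = 0}"

definition parametrized_by :: "point3 set \<Rightarrow> (complex \<Rightarrow> point3) \<Rightarrow> bool" where
  "parametrized_by C Q \<longleftrightarrow> C = zariski_closure (range Q)"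


section \<open>Infinity branches\<close>

text \<open>
  The record \<open>\<lparr>ramif = N, ser = f\<rparr>\<close> stands for the Puiseux series \<open>f(t^(1/N))\<close> without negative
  exponents.  It is in reduced form if \<open>N\<close> is the least common denominator of the exponents.
\<close>

record puiseux =
  ramif :: nat
  ser :: "complex fps"

definition reduced :: "puiseux \<Rightarrow> bool" where
  "reduced \<phi> \<longleftrightarrow> ramif \<phi> > 0 \<and> Gcd (insert (ramif \<phi>) {i. fps_nth (ser \<phi>) i \<noteq> 0}) = 1"

text \<open>
  With \<open>\<zeta> = 1\<close> this is \<open>r(z) = z \<phi>(1/z)\<close>, where \<open>z^(1/N)\<close> is the principal root.  In general the
  coefficient of \<open>z^(1 - i/N)\<close> is multiplied by \<open>\<zeta>^i\<close>.
\<close>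

definition branch_fun :: "puiseux \<Rightarrow> complex \<Rightarrow> complex \<Rightarrow> complex" where
  "branch_fun \<phi> \<zeta> z = z * eval_fps (ser \<phi>) (\<zeta> * z powr (- 1 / of_nat (ramif \<phi>)))"

definition converges_beyond :: "puiseux \<Rightarrow> real \<Rightarrow> bool" where
  "converges_beyond \<phi> M \<longleftrightarrow>
     (\<forall>z::complex. norm z > M \<longrightarrow>
        ereal (norm (z powr (- 1 / of_nat (ramif \<phi>)))) < fps_conv_radius (ser \<phi>))"

record branch =
  ser2 :: puiseux
  ser3 :: puiseux
  radius :: real

definition branch_ramif :: "branch \<Rightarrow> nat" where
  "branch_ramif B = lcm (ramif (ser2 B)) (ramif (ser3 B))"

text \<open>The leaf belonging to a \<open>branch_ramif B\<close>-th root of unity \<open>c\<close>, as a function of \<open>z\<close>.\<close>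

definition leaf_point :: "branch \<Rightarrow> complex \<Rightarrow> complex \<Rightarrow> point3" where
  "leaf_point B c z =
     (z, branch_fun (ser2 B) (c ^ (branch_ramif B div ramif (ser2 B))) z,
         branch_fun (ser3 B) (c ^ (branch_ramif B div ramif (ser3 B))) z)"

definition leaf :: "branch \<Rightarrow> complex \<Rightarrow> point3 set" where
  "leaf B c = {leaf_point B c z | z. norm z > radius B}"

definition branch_set :: "branch \<Rightarrow> point3 set" where
  "branch_set B = (\<Union>c\<in>{c. c ^ branch_ramif B = 1}. leaf B c)"

definition infinity_branch :: "point3 set \<Rightarrow> branch \<Rightarrow> bool" where
  "infinity_branch C B \<longleftrightarrow>
     reduced (ser2 B) \<and> reduced (ser3 B) \<and> radius B \<ge> 0 \<and>
     converges_beyond (ser2 B) (radius B) \<and> converges_beyond (ser3 B) (radius B) \<and>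
     leaf B 1 \<subseteq> C"

definition infinity_point :: "branch \<Rightarrow> complex \<times> complex \<times> complex \<times> complex" where
  "infinity_point B = (1, fps_nth (ser (ser2 B)) 0, fps_nth (ser (ser3 B)) 0, 0)"

text \<open>
  The terms of \<open>r\<close> with non-negative exponent \<open>1 - i/N\<close> are those with \<open>i \<le> N\<close>.  Their exponents,
  written over a common denominator without common factor, have the following denominator.
\<close>

definition trunc_denom :: "puiseux \<Rightarrow> nat" where
  "trunc_denom \<phi> =
     ramif \<phi> div Gcd (insert (ramif \<phi>) {i. i \<le> ramif \<phi> \<and> fps_nth (ser \<phi>) i \<noteq> 0})"

definition branch_degree :: "branch \<Rightarrow> nat" where
  "branch_degree B = lcm (trunc_denom (ser2 B)) (trunc_denom (ser3 B))"

text \<open>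
  Removal of the terms of \<open>r\<close> with negative exponent.  The result need not be in reduced form; this
  does not affect \<^const>\<open>branch_set\<close>, in which leaves are then merely listed repeatedly.
\<close>

definition trunc_puiseux :: "puiseux \<Rightarrow> puiseux" where
  "trunc_puiseux \<phi> = \<phi>\<lparr>ser := fps_cutoff (Suc (ramif \<phi>)) (ser \<phi>)\<rparr>"

definition trunc_branch :: "branch \<Rightarrow> real \<Rightarrow> branch" where
  "trunc_branch B M = \<lparr>ser2 = trunc_puiseux (ser2 B), ser3 = trunc_puiseux (ser3 B), radius = M\<rparr>"

text \<open>
  The polynomial obtained from the truncation of \<open>r(z)\<close> by substituting \<open>z = t^n\<close>.  The division is
  exact for nonzero coefficients when \<open>n\<close> is a multiple of \<open>trunc_denom \<phi>\<close>.
\<close>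

definition trunc_poly :: "nat \<Rightarrow> puiseux \<Rightarrow> complex poly" where
  "trunc_poly n \<phi> =
     (\<Sum>i\<le>ramif \<phi>. monom (fps_nth (ser \<phi>) i) ((n * (ramif \<phi> - i)) div ramif \<phi>))"

definition trunc_param :: "branch \<Rightarrow> complex \<Rightarrow> point3" where
  "trunc_param B t = (t ^ branch_degree B,
     poly (trunc_poly (branch_degree B) (ser2 B)) t,
     poly (trunc_poly (branch_degree B) (ser3 B)) t)"


section \<open>Asymptotes\<close>

text \<open>A curve is closed and nonempty, so \<^const>\<open>infdist\<close> is the minimal distance.\<close>

definition approaches :: "point3 set \<Rightarrow> point3 set \<Rightarrow> branch \<Rightarrow> bool" where
  "approaches D C B \<longleftrightarrow> infinity_branch C B \<and>
     (\<exists>c. c ^ branch_ramif B = 1 \<and> ((\<lambda>z. infdist (leaf_point B c z) D) \<longlongrightarrow> 0) at_infinity)"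

text \<open>
  Infinity branches are taken at points of the form \<open>(1:m2:m3:0)\<close> only, so this notion is meant for
  curves whose points at infinity are all of that form.
\<close>

definition perfect :: "point3 set \<Rightarrow> bool" where
  "perfect C \<longleftrightarrow> space_curve C \<and>
     (\<exists>d. has_degree C d \<and>
        (\<forall>B D e. infinity_branch C B \<and> space_curve D \<and> has_degree D e \<and> e < d \<longrightarrow>
           \<not> approaches D C B))"

definition g_asymptote :: "point3 set \<Rightarrow> point3 set \<Rightarrow> branch \<Rightarrow> bool" where
  "g_asymptote D C B \<longleftrightarrow> perfect D \<and> approaches D C B"

end

theory Submission
  imports Defs "HOL-Complex_Analysis.Complex_Analysis"
begin

text \<open>
  Write \<open>n\<close> for the degree of the branch and \<open>Q\<close> for the truncated parametrization.  Its range is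
  Zariski closed, because \<open>t\<close> is integral over \<open>t^n\<close>, and it is an irreducible curve of degree \<open>n\<close>,
  because \<open>Q\<close> is injective up to finitely many points.

  Suppose a curve \<open>D\<close> of degree \<open>e\<close> contains points that come arbitrarily close to points \<open>Q t\<close> with
  \<open>t\<close> tending to infinity.  A generic projection maps \<open>D\<close> into a plane curve \<open>P (x, w) = 0\<close>, all but
  finitely many of whose fibres over \<open>x\<close> lift back to \<open>D\<close>; let \<open>q\<close> be the projected coordinate of
  \<open>Q\<close>.  That \<open>P (t^n, q t + v)\<close> has small roots \<open>v\<close> along some sequence of \<open>t\<close> is a condition on the
  degrees of its coefficients as polynomials in \<open>t\<close>.  It therefore yields small roots for all large
  \<open>t\<close>, in particular for the \<open>n\<close> conjugates \<open>\<zeta> * t\<close> with \<open>\<zeta>^n = 1\<close>.  The values \<open>q (\<zeta> * t)\<close> drift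
  apart, so the plane \<open>x = t^n\<close> meets \<open>D\<close> in at least \<open>n\<close> points.  The same holds for generic planes
  near it, whence \<open>e \<ge> n\<close>.
\<close>

section \<open>Polynomial functions\<close>

text \<open>The degree controls only planes off the zero set of an unknown polynomial F, while the
  points found on D lie over special planes x = s. Hence the tilt to x + \<eta> (y + k z) = s with
  small \<eta>: distinct values of w = y + k z still count distinct points of D, and only an
  inequality of cardinalities is needed. The number k serves twice: F must not vanish on this whole
  family of planes, and y + k z must still distinguish the n conjugates. Each condition excludes
  finitely many k. Perfectness speaks of every branch of the truncated curve and every leaf of it,
  although an infinity branch is only required to have the leaf with c = 1 on the curve. So the
  lower bound is proved for arbitrary sequences of points Q t with t tending to infinity, and
  analytic continuation carries the other leaves onto the curve. Elimination rests on one device, an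
  element of least degree in an ideal and pseudo-division by it: it gives the extension of partial
  solutions, the plane equation of a projected component and the generic simplicity of plane
  sections.\<close>

definition eval2 :: "complex poly poly \<Rightarrow> complex \<Rightarrow> complex \<Rightarrow> complex" where
  "eval2 P x w = poly (poly P [:w:]) x"

lemma eval2_simps [simp]:
  "eval2 0 x w = 0" "eval2 1 x w = 1" "eval2 (P + R) x w = eval2 P x w + eval2 R x w"
  "eval2 (P * R) x w = eval2 P x w * eval2 R x w" "eval2 [:q:] x w = poly q x"
  "eval2 (P - R) x w = eval2 P x w - eval2 R x w" "eval2 (P ^ k) x w = eval2 P x w ^ k"
  "eval2 (smult q P) x w = poly q x * eval2 P x w"
  by (simp_all add: eval2_def)

lemma eval3_simps [simp]:
  "eval3 0 p = 0" "eval3 1 p = 1" "eval3 (f + g) p = eval3 f p + eval3 g p"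
  "eval3 (f * g) p = eval3 f p * eval3 g p" "eval3 (f - g) p = eval3 f p - eval3 g p"
  by (cases p; simp)+

lemma eval4_simps [simp]:
  "eval4 0 a b c e = 0" "eval4 1 a b c e = 1"
  "eval4 (F + G) a b c e = eval4 F a b c e + eval4 G a b c e"
  "eval4 (F * G) a b c e = eval4 F a b c e * eval4 G a b c e"
  "eval4 (F - G) a b c e = eval4 F a b c e - eval4 G a b c e"
  by (simp_all add: eval4_def)

text \<open>Explicit polynomials in nested variables are unwieldy. Membership here follows from the
  rules \<open>polyfun\<close>, and \<open>polyfuns_1\<close> to \<open>polyfuns_4\<close> then
  supply a polynomial inducing the function.\<close>

inductive_set polyfuns :: "('a \<Rightarrow> complex) set \<Rightarrow> ('a \<Rightarrow> complex) set" for X where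
  gen: "f \<in> X \<Longrightarrow> f \<in> polyfuns X"
| const: "(\<lambda>_. c) \<in> polyfuns X"
| add: "f \<in> polyfuns X \<Longrightarrow> g \<in> polyfuns X \<Longrightarrow> (\<lambda>x. f x + g x) \<in> polyfuns X"
| mult: "f \<in> polyfuns X \<Longrightarrow> g \<in> polyfuns X \<Longrightarrow> (\<lambda>x. f x * g x) \<in> polyfuns X"

named_theorems polyfun

lemmas [polyfun] = polyfuns.const polyfuns.add polyfuns.mult

lemma polyfuns_diff [polyfun]:
  assumes "f \<in> polyfuns X" "g \<in> polyfuns X"
  shows "(\<lambda>x. f x - g x) \<in> polyfuns X"
  using polyfuns.add[OF assms(1) polyfuns.mult[OF polyfuns.const[of "-1"] assms(2)]] by simp

lemma polyfuns_power [polyfun]: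
  assumes "f \<in> polyfuns X" shows "(\<lambda>x. f x ^ k) \<in> polyfuns X"
proof (induction k)
  case 0 show ?case unfolding power_0 by (rule polyfun)
next
  case (Suc k) show ?case unfolding power_Suc by (intro polyfun assms Suc.IH)
qed

lemma polyfuns_poly [polyfun]:
  assumes "f \<in> polyfuns X" shows "(\<lambda>x. poly q (f x)) \<in> polyfuns X"
proof (induction q)
  case 0 show ?case unfolding poly_0 by (rule polyfun)
next
  case (pCons a q) show ?case
    unfolding poly_pCons by (intro polyfun assms pCons.IH)
qed

lemma polyfuns_eval2 [polyfun]:
  assumes "f \<in> polyfuns X" "g \<in> polyfuns X"
  shows "(\<lambda>x. eval2 P (f x) (g x)) \<in> polyfuns X"
  unfolding eval2_def
proof (induction P)
  case 0 show ?case unfolding poly_0 by (rule polyfun)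
next
  case (pCons a P) show ?case
    unfolding poly_pCons poly_add poly_mult poly_0 mult_zero_right add_0_right
    by (intro polyfun assms pCons.IH)
qed

lemma polyfuns_eval3 [polyfun]:
  assumes "f \<in> polyfuns X" "g \<in> polyfuns X" "h \<in> polyfuns X"
  shows "(\<lambda>x. eval3 P (f x, g x, h x)) \<in> polyfuns X"
  unfolding eval3.simps
proof (induction P)
  case 0 show ?case unfolding poly_0 by (rule polyfun)
next
  case (pCons a P) show ?case
    unfolding poly_pCons poly_add poly_mult poly_0 mult_zero_right add_0_right
    by (intro polyfun assms pCons.IH polyfuns_eval2[OF assms(1,2), unfolded eval2_def])
qed

lemma polyfuns_eval4 [polyfun]:
  assumes "f \<in> polyfuns X" "g \<in> polyfuns X" "h \<in> polyfuns X" "k \<in> polyfuns X"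
  shows "(\<lambda>x. eval4 P (f x) (g x) (h x) (k x)) \<in> polyfuns X"
  unfolding eval4_def
proof (induction P)
  case 0 show ?case unfolding poly_0 by (rule polyfun)
next
  case (pCons a P) show ?case
    unfolding poly_pCons poly_add poly_mult poly_0 mult_zero_right add_0_right
    by (intro polyfun assms pCons.IH polyfuns_eval3[OF assms(1-3), unfolded eval3.simps])
qed

lemma polyfuns_1:
  assumes "f \<in> polyfuns {\<lambda>x. x}" shows "\<exists>q. \<forall>x. f x = poly q x"
  using assms
proof induction
  case (gen f) then show ?case by (auto intro!: exI[of _ "[:0, 1:]"])
next
  case (const c) show ?case by (auto intro!: exI[of _ "[:c:]"])
next
  case (add f g) then show ?case by (metis poly_add)
next
  case (mult f g) then show ?case by (metis poly_mult)
qed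

lemma polyfuns_2:
  assumes "f \<in> polyfuns {fst, snd}" shows "\<exists>P. \<forall>x w. f (x, w) = eval2 P x w"
  using assms
proof induction
  case (gen f) then show ?case
    by (auto intro: exI[of _ "[:[:0, 1:]:]"] exI[of _ "[:0, 1:]"] simp: eval2_def)
next
  case (const c) show ?case by (auto intro!: exI[of _ "[:[:c:]:]"])
next
  case (add f g) then show ?case by (metis eval2_simps(3))
next
  case (mult f g) then show ?case by (metis eval2_simps(4))
qed

lemma polyfuns_3:
  assumes "f \<in> polyfuns {fst, fst \<circ> snd, snd \<circ> snd}" shows "\<exists>g. \<forall>p. f p = eval3 g p"
  using assms
proof induction
  case (gen f) then show ?case
    by (auto intro: exI[of _ "[:[:[:0, 1:]:]:]"] exI[of _ "[:[:0, 1:]:]"] exI[of _ "[:0, 1:]"])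
next
  case (const c) show ?case by (auto intro!: exI[of _ "[:[:[:c:]:]:]"])
next
  case (add f g) then show ?case by (metis eval3_simps(3))
next
  case (mult f g) then show ?case by (metis eval3_simps(4))
qed

lemma polyfuns_4:
  assumes "f \<in> polyfuns {\<lambda>(a, b, c, e). a, \<lambda>(a, b, c, e). b, \<lambda>(a, b, c, e). c, \<lambda>(a, b, c, e). e}"
  shows "\<exists>F. \<forall>a b c e. f (a, b, c, e) = eval4 F a b c e"
  using assms
proof induction
  case (gen f) then show ?case unfolding eval4_def
    by (auto intro: exI[of _ "[:[:[:[:0, 1:]:]:]:]"] exI[of _ "[:[:[:0, 1:]:]:]"] exI[of _ "[:[:0, 1:]:]"]
        exI[of _ "[:0, 1:]"])
next
  case (const c) show ?case by (auto intro!: exI[of _ "[:[:[:[:c:]:]:]:]"] simp: eval4_def)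
next
  case (add f g) then show ?case by (metis eval4_simps(3))
next
  case (mult f g) then show ?case by (metis eval4_simps(4))
qed

section \<open>Points at which a nonzero polynomial does not vanish\<close>

lemma polyfuns_finite_zeros:
  assumes "f \<in> polyfuns {\<lambda>x. x}" "f x0 \<noteq> 0" shows "finite {x. f x = 0}"
proof -
  obtain q where q: "\<And>x. f x = poly q x" using polyfuns_1[OF assms(1)] by blast
  with assms(2) have "q \<noteq> 0" by auto
  then show ?thesis by (simp add: q poly_roots_finite)
qed

text \<open>Used with \<open>h\<close> embedding the constants into the coefficient ring of the
  outermost variable, so that variables can be specialized one at a time.\<close>

lemma finite_zeros_at_embedded:
  fixes F :: "'a::idom poly" and h :: "complex \<Rightarrow> 'a"
  assumes "F \<noteq> 0" "inj h" shows "finite {w. poly F (h w) = 0}"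
proof -
  have "finite (h -` {a. poly F a = 0})"
    by (intro finite_vimageI poly_roots_finite assms)
  then show ?thesis by (simp add: vimage_def)
qed

lemma ex_avoiding_finite: "finite (A :: complex set) \<Longrightarrow> \<exists>x. x \<notin> A"
  using ex_new_if_finite infinite_UNIV_char_0 by blast

lemma ex_eval2_nonzero:
  assumes "P \<noteq> 0" shows "\<exists>x w. eval2 P x w \<noteq> 0"
proof -
  obtain w where w: "poly P [:w:] \<noteq> 0"
    using ex_avoiding_finite[OF finite_zeros_at_embedded[OF assms, of "\<lambda>w. [:w:]"]] by (auto simp: inj_def)
  obtain x where "poly (poly P [:w:]) x \<noteq> 0"
    using w poly_all_0_iff_0 by blast
  then show ?thesis by (auto simp: eval2_def)
qed

text \<open>Nonzero \<open>a\<close> and \<open>b\<close> allow the normal vector to be written as a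
  * (1, \<eta>, \<eta> * k) with \<eta> = b / a and k = c / b.\<close>

lemma ex_eval4_nonzero:
  assumes "F \<noteq> 0" shows "\<exists>a b c e. a \<noteq> 0 \<and> b \<noteq> 0 \<and> eval4 F a b c e \<noteq> 0"
proof -
  obtain e where e: "poly F [:[:[:e:]:]:] \<noteq> 0"
    using ex_avoiding_finite[OF finite_zeros_at_embedded[OF assms, of "\<lambda>w. [:[:[:w:]:]:]"]] by (auto simp: inj_def)
  obtain c where c: "poly (poly F [:[:[:e:]:]:]) [:[:c:]:] \<noteq> 0"
    using ex_avoiding_finite[OF finite_zeros_at_embedded[OF e, of "\<lambda>w. [:[:w:]:]"]] by (auto simp: inj_def)
  obtain b where b: "b \<noteq> 0" "poly (poly (poly F [:[:[:e:]:]:]) [:[:c:]:]) [:b:] \<noteq> 0"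
    using ex_avoiding_finite[OF finite.insertI[OF finite_zeros_at_embedded[OF c, of "\<lambda>w. [:w:]"]], of 0]
    by (auto simp: inj_def)
  obtain a where a: "a \<noteq> 0" "poly (poly (poly (poly F [:[:[:e:]:]:]) [:[:c:]:]) [:b:]) a \<noteq> 0"
    using ex_avoiding_finite[OF finite.insertI[OF poly_roots_finite[OF b(2)]], of 0] by auto
  from a b show ?thesis unfolding eval4_def by blast
qed

declare eval3.simps [simp del]

section \<open>Elements of least degree in ideals of polynomials\<close>

definition is_ideal :: "'a::comm_ring_1 set \<Rightarrow> bool" where
  "is_ideal J \<longleftrightarrow> 0 \<in> J \<and> (\<forall>f\<in>J. \<forall>g\<in>J. f + g \<in> J) \<and> (\<forall>f\<in>J. \<forall>h. h * f \<in> J)"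

lemma is_ideal_diff: "is_ideal J \<Longrightarrow> f \<in> J \<Longrightarrow> g \<in> J \<Longrightarrow> f - g \<in> J"
  unfolding is_ideal_def by (metis add_uminus_conv_diff mult_minus1)

text \<open>The \<open>a\<close> with \<open>[:a:]\<close> in \<open>J\<close> form the contraction
  of \<open>J\<close> to the coefficient ring. Once the leading coefficient lies in it, subtracting
  the leading term leaves an element of \<open>J\<close> of smaller degree.\<close>

lemma coeffs_in_contraction:
  fixes J :: "'a::idom poly set"
  assumes J: "is_ideal J"
    and low: "\<And>f. f \<in> J \<Longrightarrow> degree f < N \<Longrightarrow> [:lead_coeff f:] \<in> J"
    and f: "f \<in> J" "degree f < N"
  shows "[:coeff f i:] \<in> J"
  using f
proof (induction "degree f" arbitrary: f rule: less_induct)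
  case less
  define g where "g = f - monom (lead_coeff f) (degree f)"
  have lc: "[:lead_coeff f:] \<in> J" using low less by blast
  have "monom (lead_coeff f) (degree f) = monom 1 (degree f) * [:lead_coeff f:]"
    by (simp add: smult_monom)
  then have gJ: "g \<in> J"
    unfolding g_def using is_ideal_diff[OF J less(2)] lc J by (auto simp: is_ideal_def)
  show ?case
  proof (cases "degree f = 0")
    case True
    then show ?thesis using lc J
      by (cases "i = 0") (auto simp: is_ideal_def coeff_eq_0)
  next
    case False
    have cg: "coeff g j = (if j = degree f then 0 else coeff f j)" for j
      by (auto simp: g_def)
    have "degree g < degree f"
    proof -
      have "degree g \<le> degree f - 1"
        by (rule degree_le) (use False in \<open>auto simp: cg coeff_eq_0\<close>)
      then show ?thesis using False by simp
    qed
    then have "[:coeff g i:] \<in> J" using less gJ by auto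
    then show ?thesis using lc by (auto simp: cg split: if_splits)
  qed
qed

text \<open>Modulo the contraction, \<open>g\<close> generates \<open>J\<close> up to powers of its
  leading coefficient: a pseudo-remainder lies in \<open>J\<close> and has smaller degree than
  \<open>g\<close>, so minimality puts all its coefficients into the contraction.\<close>

lemma pseudo_division_least_degree:
  fixes J :: "'a::idom poly set"
  assumes J: "is_ideal J" and g: "g \<in> J" "[:lead_coeff g:] \<notin> J"
    and least: "\<And>f. f \<in> J \<Longrightarrow> [:lead_coeff f:] \<notin> J \<Longrightarrow> degree g \<le> degree f"
  shows "degree g > 0"
    and "f \<in> J \<Longrightarrow> \<exists>k q. \<forall>i. [:coeff (smult (lead_coeff g ^ k) f - g * q) i:] \<in> J"
proof -
  show "degree g > 0"
    using g by (metis coeff_pCons_0 degree_eq_zeroE gr_zeroI)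
  assume f: "f \<in> J"
  have g0: "g \<noteq> 0" using g J by (auto simp: is_ideal_def)
  obtain q r where qr: "pseudo_divmod f g = (q, r)" by (cases "pseudo_divmod f g")
  note * = pseudo_divmod[OF g0 qr]
  define k where "k = Suc (degree f) - degree g"
  have r: "r = smult (lead_coeff g ^ k) f - g * q" using * by (simp add: k_def)
  have "smult (lead_coeff g ^ k) f = [:lead_coeff g ^ k:] * f" by simp
  then have rJ: "r \<in> J"
    unfolding r using is_ideal_diff[OF J] f g J unfolding is_ideal_def by (metis mult.commute)
  have "[:coeff r i:] \<in> J" for i
  proof (cases "r = 0")
    case True then show ?thesis using J by (simp add: is_ideal_def)
  next
    case False
    then have "degree r < degree g" using * by auto
    then show ?thesis
      using coeffs_in_contraction[OF J _ rJ, of "degree g"] least by (meson not_le)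
  qed
  then show "\<exists>k q. \<forall>i. [:coeff (smult (lead_coeff g ^ k) f - g * q) i:] \<in> J"
    unfolding r by blast
qed

lemma ex_least_degree:
  assumes "\<exists>f\<in>J. Q f"
  obtains g where "g \<in> J" "Q g" "\<And>f. f \<in> J \<Longrightarrow> Q f \<Longrightarrow> degree g \<le> degree f"
proof -
  obtain f where "f \<in> J \<and> Q f" using assms by blast
  from ex_has_least_nat[of "\<lambda>f. f \<in> J \<and> Q f", OF this, of degree] show ?thesis using that by blast
qed

lemma pseudo_division_no_constants:
  fixes J :: "'a::idom poly set"
  assumes J: "is_ideal J" and const: "\<And>a. [:a:] \<in> J \<Longrightarrow> a = 0"
    and g: "g \<in> J" "g \<noteq> 0" and least: "\<And>f. f \<in> J \<Longrightarrow> f \<noteq> 0 \<Longrightarrow> degree g \<le> degree f"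
  shows "degree g > 0"
    and "f \<in> J \<Longrightarrow> \<exists>k q. smult (lead_coeff g ^ k) f = g * q"
proof -
  have 1: "[:lead_coeff g:] \<notin> J" using g const leading_coeff_neq_0 by blast
  have 2: "f \<noteq> 0" if "[:lead_coeff f:] \<notin> J" for f using that J by (auto simp: is_ideal_def)
  show "degree g > 0"
    by (rule pseudo_division_least_degree(1)[OF J g(1) 1]) (use least 2 in auto)
  assume f: "f \<in> J"
  have "\<exists>k q. \<forall>i. [:coeff (smult (lead_coeff g ^ k) f - g * q) i:] \<in> J"
    by (rule pseudo_division_least_degree(2)[OF J g(1) 1]) (use least 2 f in auto)
  then have "\<exists>k q. \<forall>i. coeff (smult (lead_coeff g ^ k) f - g * q) i = 0" using const by blast
  then show "\<exists>k q. smult (lead_coeff g ^ k) f = g * q"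
    by (auto simp: poly_eq_iff)
qed

section \<open>Specialization of coefficients and extension of partial solutions\<close>

locale hom_to_complex =
  fixes h :: "'a::idom \<Rightarrow> complex"
  assumes hom [simp]: "h 0 = 0" "h 1 = 1" "h (a + b) = h a + h b" "h (a * b) = h a * h b"
begin

lemma hom_diff [simp]: "h (a - b) = h a - h b"
  using hom(3)[of "a - b" b] by (simp del: hom)

lemma hom_power [simp]: "h (a ^ k) = h a ^ k"
  by (induction k) auto

lemma hom_sum: "h (sum f A) = (\<Sum>x\<in>A. h (f x))"
  by (induction A rule: infinite_finite_induct) auto

lemma map_poly_add [simp]: "map_poly h (f + g) = map_poly h f + map_poly h g"
  by (rule poly_eqI) (simp add: coeff_map_poly)

lemma map_poly_diff [simp]: "map_poly h (f - g) = map_poly h f - map_poly h g"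
  by (rule poly_eqI) (simp add: coeff_map_poly)

lemma map_poly_mult [simp]: "map_poly h (f * g) = map_poly h f * map_poly h g"
  by (rule poly_eqI) (simp add: coeff_map_poly coeff_mult hom_sum)

lemma map_poly_smult [simp]: "map_poly h (smult a f) = smult (h a) (map_poly h f)"
  by (rule poly_eqI) (simp add: coeff_map_poly)

lemma degree_map_poly_hom:
  assumes "h (lead_coeff f) \<noteq> 0" shows "degree (map_poly h f) = degree f"
proof (rule antisym)
  show "degree (map_poly h f) \<le> degree f" by (rule degree_le) (simp add: coeff_map_poly coeff_eq_0)
  show "degree f \<le> degree (map_poly h f)"
    by (rule le_degree) (use assms in \<open>simp add: coeff_map_poly\<close>)
qed

text \<open>The extension theorem of elimination theory, without resultants. The specialized
  \<open>g\<close> keeps its positive degree and so has a root; after specialization pseudo-division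
  by \<open>g\<close> is exact and passes this root on to all of \<open>J\<close>.\<close>

lemma common_root_least_degree:
  fixes J :: "'a poly set"
  assumes J: "is_ideal J" and g: "g \<in> J" "[:lead_coeff g:] \<notin> J"
    and least: "\<And>f. f \<in> J \<Longrightarrow> [:lead_coeff f:] \<notin> J \<Longrightarrow> degree g \<le> degree f"
    and h: "\<And>a. [:a:] \<in> J \<Longrightarrow> h a = 0" "h (lead_coeff g) \<noteq> 0"
  shows "\<exists>v. \<forall>f\<in>J. poly (map_poly h f) v = 0"
proof -
  have "degree (map_poly h g) > 0"
    using pseudo_division_least_degree(1)[OF J g least] degree_map_poly_hom[OF h(2)] by simp
  then obtain v where v: "poly (map_poly h g) v = 0"
    using Fundamental_Theorem_Algebra.fundamental_theorem_of_algebra[of "map_poly h g"]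
      by (auto simp: constant_degree)
  have "poly (map_poly h f) v = 0" if f: "f \<in> J" for f
  proof -
    obtain k q where kq: "\<And>i. [:coeff (smult (lead_coeff g ^ k) f - g * q) i:] \<in> J"
      using pseudo_division_least_degree(2)[OF J g least f] by blast
    have "map_poly h (smult (lead_coeff g ^ k) f - g * q) = 0"
      using h(1)[OF kq] by (intro poly_eqI) (simp only: coeff_map_poly hom coeff_0)
    then have "poly (smult (h (lead_coeff g) ^ k) (map_poly h f)) v = poly (map_poly h g * map_poly h q) v"
      by simp
    then show ?thesis using v h(2) by simp
  qed
  then show ?thesis by blast
qed

end

section \<open>Algebraic sets and their projections\<close>

definition vanishing :: "point3 set \<Rightarrow> complex poly3 set" where
  "vanishing V = {g. \<forall>p\<in>V. eval3 g p = 0}"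

lemma is_ideal_vanishing: "is_ideal (vanishing V)"
  by (auto simp: is_ideal_def vanishing_def)

lemma algebraic_memI:
  assumes "algebraic V" "\<And>g. g \<in> vanishing V \<Longrightarrow> eval3 g p = 0" shows "p \<in> V"
  using assms unfolding algebraic_def zero_set_def vanishing_def by blast

lemma algebraic_zariski_closure: "algebraic (zariski_closure S)"
  by (auto simp: zariski_closure_def algebraic_def)

lemma subset_zariski_closure: "S \<subseteq> zariski_closure S"
  by (auto simp: zariski_closure_def zero_set_def)

lemma zariski_closure_minimal: "algebraic V \<Longrightarrow> S \<subseteq> V \<Longrightarrow> zariski_closure S \<subseteq> V"
  by (force simp: zariski_closure_def zero_set_def algebraic_def)

lemma algebraic_Un:
  assumes "algebraic V" "algebraic W" shows "algebraic (V \<union> W)"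
proof -
  have "V \<union> W = zero_set {f * g | f g. f \<in> vanishing V \<and> g \<in> vanishing W}" (is "_ = zero_set ?G")
  proof
    show "V \<union> W \<subseteq> zero_set ?G" by (auto simp: zero_set_def vanishing_def)
    show "zero_set ?G \<subseteq> V \<union> W"
    proof (rule subsetI, rule ccontr)
      fix p assume p: "p \<in> zero_set ?G" "p \<notin> V \<union> W"
      obtain f g where "f \<in> vanishing V" "eval3 f p \<noteq> 0" "g \<in> vanishing W" "eval3 g p \<noteq> 0"
        using algebraic_memI assms p by (metis UnI1 UnI2)
      moreover have "eval3 (f * g) p = 0" if "f \<in> vanishing V" "g \<in> vanishing W" for f g
        using p(1) that unfolding zero_set_def by blast
      ultimately show False by (metis eval3_simps(4) mult_eq_0_iff)
    qed
  qed
  then show ?thesis by (auto simp: algebraic_def)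
qed

lemma algebraic_zero_subset:
  assumes "algebraic V" shows "algebraic {p \<in> V. eval3 f p = 0}"
proof -
  obtain G where "V = zero_set G" using assms by (auto simp: algebraic_def)
  then have "{p \<in> V. eval3 f p = 0} = zero_set (insert f G)" by (auto simp: zero_set_def)
  then show ?thesis by (auto simp: algebraic_def)
qed

lemma algebraic_singleton: "algebraic {p}"
proof -
  obtain a b c where p: "p = (a, b, c)" by (cases p)
  have "{p} = zero_set {[:[:[:- a, 1:]:]:], [:[:[:- b:], 1:]:], [:[:[:- c:]:], 1:]}"
    by (auto simp: zero_set_def p add_eq_0_iff eval3.simps)
  then show ?thesis by (auto simp: algebraic_def)
qed

lemma algebraic_finite: "finite V \<Longrightarrow> algebraic V"
proof (induction rule: finite_induct)
  case empty
  have "{} = zero_set {1}" by (auto simp: zero_set_def)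
  then show ?case by (auto simp: algebraic_def)
next
  case (insert x V)
  then show ?case using algebraic_Un[OF algebraic_singleton[of x], of V] by simp
qed

lemma irreducible_algebraic_cases:
  assumes "irreducible_algebraic V" "V = V1 \<union> V2" "algebraic V1" "algebraic V2"
  shows "V = V1 \<or> V = V2"
  using assms by (simp add: irreducible_algebraic_def)

lemma irreducible_singleton: "irreducible_algebraic {p}"
  unfolding irreducible_algebraic_def
proof (intro conjI allI impI)
  fix V1 V2 assume *: "algebraic V1 \<and> algebraic V2 \<and> {p} = V1 \<union> V2"
  then have "V1 = {} \<or> V1 = {p}" by (metis Un_upper1 subset_singletonD)
  with * show "{p} = V1 \<or> {p} = V2" by auto
qed (auto simp: algebraic_singleton)

lemma irreducible_finite:
  assumes "irreducible_algebraic V" "finite V" obtains p where "V = {p}"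
proof -
  obtain p where p: "p \<in> V" using assms by (auto simp: irreducible_algebraic_def)
  have "algebraic (V - {p})" using assms by (intro algebraic_finite) auto
  moreover have "V = {p} \<union> (V - {p})" using p by auto
  ultimately have "V = {p}"
    using assms algebraic_singleton[of p] p unfolding irreducible_algebraic_def by blast
  then show ?thesis using that by blast
qed

lemma vanishing_prime:
  assumes "irreducible_algebraic V" "f * g \<in> vanishing V"
  shows "f \<in> vanishing V \<or> g \<in> vanishing V"
proof -
  have "V = {p \<in> V. eval3 f p = 0} \<union> {p \<in> V. eval3 g p = 0}"
    using assms(2) by (auto simp: vanishing_def)
  then have "V = {p \<in> V. eval3 f p = 0} \<or> V = {p \<in> V. eval3 g p = 0}"
    using assms(1)
    by (intro irreducible_algebraic_cases[OF assms(1)] algebraic_zero_subset)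
      (auto simp: irreducible_algebraic_def)
  then show ?thesis by (auto simp: vanishing_def)
qed

interpretation at_point: hom_to_complex "\<lambda>c. eval2 c x w" for x w
  by unfold_locales auto

interpretation at_value: hom_to_complex "\<lambda>q. poly q s" for s
  by unfold_locales auto

lemma eval3_map_poly: "eval3 f (x, w, z) = poly (map_poly (\<lambda>c. eval2 c x w) f) z"
  by (induction f) (auto simp: map_poly_pCons eval2_def eval3.simps)

lemma eval2_map_poly: "eval2 P s w = poly (map_poly (\<lambda>q. poly q s) P) w"
  unfolding eval2_def by (induction P) (auto simp: map_poly_pCons)

lemma eval3_const [simp]: "eval3 [:c:] (x, w, z) = eval2 c x w"
  by (simp add: eval2_def eval3.simps)

text \<open>Over a common zero of the equations free of z, a point of \<open>V\<close> can be
  missing only where the leading coefficient of a least-degree element vanishes.\<close>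

lemma generic_lift:
  assumes "algebraic V" "V \<noteq> {}"
  shows "\<exists>r. [:r:] \<notin> vanishing V \<and>
    (\<forall>x w. (\<forall>c. [:c:] \<in> vanishing V \<longrightarrow> eval2 c x w = 0) \<and> eval2 r x w \<noteq> 0 \<longrightarrow> (\<exists>z. (x, w, z) \<in> V))"
proof (cases "\<exists>f\<in>vanishing V. [:lead_coeff f:] \<notin> vanishing V")
  case True
  obtain g where g: "g \<in> vanishing V" "[:lead_coeff g:] \<notin> vanishing V"
    "\<And>f. f \<in> vanishing V \<Longrightarrow> [:lead_coeff f:] \<notin> vanishing V \<Longrightarrow> degree g \<le> degree f"
    using ex_least_degree[OF True] by metis
  have "\<exists>z. (x, w, z) \<in> V"
    if xw: "\<And>c. [:c:] \<in> vanishing V \<Longrightarrow> eval2 c x w = 0" "eval2 (lead_coeff g) x w \<noteq> 0" for x w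
  proof -
    obtain z where "\<forall>f\<in>vanishing V. poly (map_poly (\<lambda>c. eval2 c x w) f) z = 0"
      using at_point.common_root_least_degree[OF is_ideal_vanishing g xw] by blast
    then have "(x, w, z) \<in> V"
      by (intro algebraic_memI[OF assms(1)]) (simp add: eval3_map_poly)
    then show ?thesis by blast
  qed
  then show ?thesis using g(2) by blast
next
  case False
  have "\<exists>z. (x, w, z) \<in> V" if xw: "\<And>c. [:c:] \<in> vanishing V \<Longrightarrow> eval2 c x w = 0" for x w
  proof
    \<comment> \<open>Here \<open>V\<close> is a cylinder in the direction of z, so any last
      coordinate would do.\<close>
    show "(x, w, 0) \<in> V"
    proof (rule algebraic_memI[OF assms(1)])
      fix f assume f: "f \<in> vanishing V"
      have "[:coeff f i:] \<in> vanishing V" for i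
        using coeffs_in_contraction[OF is_ideal_vanishing _ f lessI] False by blast
      then have "map_poly (\<lambda>c. eval2 c x w) f = 0"
        by (intro poly_eqI) (simp add: coeff_map_poly xw)
      then show "eval3 f (x, w, 0) = 0" by (simp add: eval3_map_poly)
    qed
  qed
  moreover have "[:1:] \<notin> vanishing V"
    using assms(2) by (force simp: vanishing_def)
  ultimately show ?thesis by blast
qed

text \<open>Away from finitely many vertical lines the single equation \<open>P\<close> replaces all
  of \<open>K\<close>, because a least-degree element generates \<open>K\<close> up to factors in x.
  The same lines absorb the points where \<open>r\<close> vanishes, because \<open>r\<close> is not
  in the prime ideal \<open>K\<close>.\<close>

lemma plane_prime_ideal:
  fixes K :: "complex poly poly set"
  assumes K: "is_ideal K" and prime: "\<And>f g. f * g \<in> K \<Longrightarrow> f \<in> K \<or> g \<in> K"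
    and r: "r \<notin> K" and nz: "\<exists>f\<in>K. f \<noteq> 0"
  shows "\<exists>P\<in>K. P \<noteq> 0 \<and> (\<exists>S. finite S \<and>
    (\<forall>s w. s \<notin> S \<and> eval2 P s w = 0 \<longrightarrow> (\<forall>c\<in>K. eval2 c s w = 0) \<and> eval2 r s w \<noteq> 0))"
proof (cases "\<exists>q. q \<noteq> 0 \<and> [:q:] \<in> K")
  case True
  then obtain q where q: "q \<noteq> 0" "[:q:] \<in> K" by blast
  \<comment> \<open>The zero set lies on finitely many vertical lines; with these as
    \<open>S\<close> the claim is vacuous.\<close>
  show ?thesis
    by (rule bexI[of _ "[:q:]"], intro conjI exI[of _ "{s. poly q s = 0}"])
      (use q in \<open>auto intro: poly_roots_finite\<close>)
next
  case False
  then have const: "a = 0" if "[:a:] \<in> K" for a using that by blast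
  obtain g where g: "g \<in> K" "g \<noteq> 0" and least: "\<And>f. f \<in> K \<Longrightarrow> f \<noteq> 0 \<Longrightarrow> degree g \<le> degree f"
    using ex_least_degree[OF nz] by metis
  note div = pseudo_division_no_constants[OF K const g least]
  have lc_notin: "[:lead_coeff g:] \<notin> K" using const g by fastforce
  \<comment> \<open>A nonzero \<open>a\<close> in \<open>J\<close> free of w equals a multiple of
    \<open>r\<close> modulo \<open>K\<close>, so on the zero set of \<open>K\<close> the polynomial
    \<open>r\<close> can vanish only above roots of \<open>a\<close>.\<close>
  define J where "J = {u * r + f | u f. f \<in> K}"
  have J: "is_ideal J" unfolding is_ideal_def
  proof (intro conjI ballI allI)
    have "0 * r + 0 \<in> J" using K unfolding J_def is_ideal_def by blast
    then show "0 \<in> J" by simp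
  next
    fix f g assume "f \<in> J" "g \<in> J"
    then obtain u f' v g' where "f = u * r + f'" "g = v * r + g'" "f' \<in> K" "g' \<in> K"
      unfolding J_def by blast
    moreover from this have "f + g = (u + v) * r + (f' + g')" by (simp add: algebra_simps)
    ultimately show "f + g \<in> J" using K unfolding J_def is_ideal_def by blast
  next
    fix f h assume "f \<in> J"
    then obtain u f' where "f = u * r + f'" "f' \<in> K" unfolding J_def by blast
    moreover from this have "h * f = (h * u) * r + h * f'" by (simp add: algebra_simps)
    ultimately show "h * f \<in> J" using K unfolding J_def is_ideal_def by blast
  qed
  have KJ: "K \<subseteq> J"
  proof
    fix f assume "f \<in> K"
    then have "0 * r + f \<in> J" unfolding J_def by blast
    then show "f \<in> J" by simp
  qed
  have rJ: "r \<in> J"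
  proof -
    have "1 * r + 0 \<in> J" using K unfolding J_def is_ideal_def by blast
    then show ?thesis by simp
  qed
  have "\<exists>a. a \<noteq> 0 \<and> [:a:] \<in> J"
  proof (rule ccontr)
    assume "\<not> ?thesis"
    then have const': "a = 0" if "[:a:] \<in> J" for a using that by blast
    \<comment> \<open>\<open>d\<close> divides both \<open>g\<close> and \<open>r\<close> up to
      factors in x. Minimality of \<open>g\<close> keeps the cofactor \<open>q\<close> out of
      \<open>K\<close>, so primality puts \<open>d\<close>, and then \<open>r\<close>, into
      \<open>K\<close>.\<close>
    obtain d where d: "d \<in> J" "d \<noteq> 0" and least': "\<And>f. f \<in> J \<Longrightarrow> f \<noteq> 0 \<Longrightarrow> degree d \<le> degree f"
      using ex_least_degree[of J "\<lambda>f. f \<noteq> 0"] nz KJ by (metis subsetD)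
    note div' = pseudo_division_no_constants[OF J const' d least']
    obtain k q where kq: "smult (lead_coeff d ^ k) g = d * q" using div'(2) KJ g by blast
    obtain k' q' where kq': "smult (lead_coeff d ^ k') r = d * q'" using div'(2) rJ by blast
    have lc: "[:lead_coeff d ^ k:] \<notin> K" for k
      using const[of "lead_coeff d ^ k"] d(2) by auto
    have "q \<noteq> 0" "d * q \<noteq> 0" using kq g d by auto
    have "degree g = degree d + degree q"
      using arg_cong[OF kq, of degree] d \<open>q \<noteq> 0\<close> by (simp add: degree_mult_eq)
    then have "q \<notin> K" using least[of q] \<open>q \<noteq> 0\<close> div'(1) by fastforce
    moreover have "d * q = [:lead_coeff d ^ k:] * g" using kq by simp
    then have "d * q \<in> K" using K g(1) unfolding is_ideal_def by metis
    ultimately have "d \<in> K" using prime by blast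
    then have "q' * d \<in> K" using K unfolding is_ideal_def by blast
    moreover have "q' * d = [:lead_coeff d ^ k':] * r" using kq' by (simp add: mult.commute)
    ultimately have "[:lead_coeff d ^ k':] * r \<in> K" by metis
    then show False using prime lc r by blast
  qed
  then obtain a u f where a: "a \<noteq> 0" "[:a:] = u * r + f" "f \<in> K" unfolding J_def by blast
  define S where "S = {s. poly (a * lead_coeff g) s = 0}"
  have S: "finite S" unfolding S_def using a(1) g(2) by (intro poly_roots_finite) auto
  have 1: "eval2 c s w = 0" if sw: "s \<notin> S" "eval2 g s w = 0" and c: "c \<in> K" for s w c
  proof -
    obtain k q where "smult (lead_coeff g ^ k) c = g * q" using div(2) c by blast
    then have "eval2 (smult (lead_coeff g ^ k) c) s w = eval2 (g * q) s w" by simp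
    then have "poly (lead_coeff g) s ^ k * eval2 c s w = 0" using sw by (simp add: poly_power)
    then show ?thesis using sw by (simp add: S_def)
  qed
  have 2: "eval2 r s w \<noteq> 0" if sw: "s \<notin> S" "eval2 g s w = 0" for s w
  proof
    assume "eval2 r s w = 0"
    then have "eval2 [:a:] s w = 0" using 1[OF sw a(3)] a(2) by simp
    then show False using sw by (simp add: S_def)
  qed
  show ?thesis using g S 1 2 by blast
qed

text \<open>The dimension of \<open>V\<close> does not enter. The second alternative, a projection
  dense in the plane, is excluded for components of curves in
  \<open>space_curve_projection\<close>.\<close>

lemma irreducible_projection:
  assumes V: "irreducible_algebraic V"
  shows "(\<exists>P S. P \<noteq> 0 \<and> finite S \<and> (\<forall>x w z. (x, w, z) \<in> V \<longrightarrow> eval2 P x w = 0) \<and>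
      (\<forall>s w. s \<notin> S \<and> eval2 P s w = 0 \<longrightarrow> (\<exists>z. (s, w, z) \<in> V))) \<or>
    (\<exists>r. r \<noteq> 0 \<and> (\<forall>s w. eval2 r s w \<noteq> 0 \<longrightarrow> (\<exists>z. (s, w, z) \<in> V)))"
proof -
  have V': "algebraic V" "V \<noteq> {}" using V by (auto simp: irreducible_algebraic_def)
  obtain r where r: "[:r:] \<notin> vanishing V" and lift:
    "\<And>x w. (\<And>c. [:c:] \<in> vanishing V \<Longrightarrow> eval2 c x w = 0) \<Longrightarrow> eval2 r x w \<noteq> 0 \<Longrightarrow> \<exists>z. (x, w, z) \<in> V"
    using generic_lift[OF V'] by blast
  define K where "K = {c. [:c:] \<in> vanishing V}"
  have K_iff: "c \<in> K \<longleftrightarrow> (\<forall>x w z. (x, w, z) \<in> V \<longrightarrow> eval2 c x w = 0)" for c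
    unfolding K_def vanishing_def by (force simp del: eval2_simps)
  show ?thesis
  proof (cases "\<exists>f\<in>K. f \<noteq> 0")
    case True
    have "is_ideal K" by (auto simp: is_ideal_def K_iff)
    moreover have "f \<in> K \<or> g \<in> K" if "f * g \<in> K" for f g
      using that vanishing_prime[OF V, of "[:f:]" "[:g:]"] by (simp add: K_def mult.commute)
    moreover have "r \<notin> K" using r by (simp add: K_def)
    ultimately obtain P S where P: "P \<in> K" "P \<noteq> 0" "finite S"
      "\<And>s w. s \<notin> S \<Longrightarrow> eval2 P s w = 0 \<Longrightarrow> (\<forall>c\<in>K. eval2 c s w = 0) \<and> eval2 r s w \<noteq> 0"
      using plane_prime_ideal[of K r] True by force
    have "\<exists>z. (s, w, z) \<in> V" if "s \<notin> S" "eval2 P s w = 0" for s w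
    proof -
      have "(\<forall>c\<in>K. eval2 c s w = 0) \<and> eval2 r s w \<noteq> 0" by (rule P(4)[OF that])
      then show ?thesis by (intro lift) (auto simp: K_def)
    qed
    with P(1-3) show ?thesis unfolding K_iff
      by (intro disjI1 exI[of _ P] exI[of _ S]) simp
  next
    case False
    then have "\<exists>z. (s, w, z) \<in> V" if "eval2 r s w \<noteq> 0" for s w
      using that False by (intro lift) (force simp: K_def)+
    moreover have "r \<noteq> 0" using r by (auto simp: vanishing_def)
    ultimately show ?thesis by blast
  qed
qed

subsection \<open>Shears\<close>

text \<open>Reduces the projection (x, y, z) -> (x, y + k z) to forgetting the last
  coordinate.\<close>

definition shear :: "complex \<Rightarrow> point3 \<Rightarrow> point3" where
  "shear k = (\<lambda>(x, y, z). (x, y + k * z, z))"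

lemma shear_shear [simp]: "shear k (shear (- k) p) = p" "shear (- k) (shear k p) = p"
  by (auto simp: shear_def split: prod.splits)

lemma shear_image_vimage: "shear k ` V = shear (- k) -` V"
proof
  show "shear k ` V \<subseteq> shear (- k) -` V" by auto
  show "shear (- k) -` V \<subseteq> shear k ` V"
    using shear_shear(1)[of k] by (metis image_iff subsetI vimageE)
qed

lemma algebraic_shear:
  assumes "algebraic V" shows "algebraic (shear k ` V)"
proof -
  have "\<exists>g'. \<forall>p. eval3 g (shear (- k) p) = eval3 g' p" for g
  proof -
    have "(\<lambda>p. eval3 g (fst p, (fst \<circ> snd) p + (- k) * (snd \<circ> snd) p, (snd \<circ> snd) p))
        \<in> polyfuns {fst, fst \<circ> snd, snd \<circ> snd}"
      by (intro polyfun polyfuns.gen) auto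
    from polyfuns_3[OF this] show ?thesis
      by (auto simp: shear_def split_beta)
  qed
  then obtain T where T: "\<And>g p. eval3 g (shear (- k) p) = eval3 (T g) p" by metis
  obtain G where "V = zero_set G" using assms by (auto simp: algebraic_def)
  then have "shear k ` V = zero_set (T ` G)"
    unfolding shear_image_vimage by (auto simp: zero_set_def T)
  then show ?thesis by (auto simp: algebraic_def)
qed

lemma irreducible_shear:
  assumes V: "irreducible_algebraic V" shows "irreducible_algebraic (shear k ` V)"
  unfolding irreducible_algebraic_def
proof (intro conjI allI impI)
  show "algebraic (shear k ` V)" "shear k ` V \<noteq> {}"
    using V algebraic_shear by (auto simp: irreducible_algebraic_def)
  fix V1 V2 assume *: "algebraic V1 \<and> algebraic V2 \<and> shear k ` V = V1 \<union> V2"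
  have "V = shear (- k) ` (shear k ` V)" by (simp add: image_image)
  also have "\<dots> = shear (- k) ` V1 \<union> shear (- k) ` V2" using * by (simp add: image_Un)
  finally have "V = shear (- k) ` V1 \<or> V = shear (- k) ` V2"
    using irreducible_algebraic_cases[OF V] * algebraic_shear by blast
  then show "shear k ` V = V1 \<or> shear k ` V = V2"
    by (auto simp: image_image)
qed

section \<open>Roots of polynomials depending on a parameter\<close>

text \<open>For r > 0 this is Vieta: the k-th coefficient is, up to sign, the constant one times an
  elementary symmetric function of inverse roots, each at most 1 / r in norm. Splitting off one root
  at a time doubles the constant.\<close>

lemma coeff_bound_of_large_roots:
  fixes p :: "complex poly"
  assumes "r \<ge> 0" "\<And>v. poly p v = 0 \<Longrightarrow> norm v \<ge> r"
  shows "norm (coeff p k) * r ^ k \<le> 2 ^ degree p * norm (coeff p 0)"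
  using assms(2)
proof (induction "degree p" arbitrary: p k)
  case 0
  then show ?case by (cases k) (auto simp: coeff_eq_0)
next
  case (Suc d)
  obtain a where a: "poly p a = 0"
    using Fundamental_Theorem_Algebra.fundamental_theorem_of_algebra[of p] Suc.hyps(2)
    by (auto simp: constant_degree)
  obtain q where q: "p = [:- a, 1:] * q" using a by (auto simp: poly_eq_0_iff_dvd elim: dvdE)
  have "q \<noteq> 0" using q Suc.hyps(2) by auto
  then have dq: "degree q = d" using Suc.hyps(2) unfolding q by (subst (asm) degree_mult_eq) auto
  have IH: "norm (coeff q k) * r ^ k \<le> 2 ^ d * norm (coeff q 0)" for k
    using Suc.hyps(1)[of q] dq Suc.prems by (simp add: q)
  have ra: "r \<le> norm a" using Suc.prems a by simp
  have c0: "norm (coeff p 0) = norm a * norm (coeff q 0)" by (simp add: q norm_mult)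
  have 1: "norm (a * coeff q k) * r ^ k \<le> 2 ^ d * norm (coeff p 0)" for k
    using mult_left_mono[OF IH[of k], of "norm a"] by (simp add: c0 norm_mult mult_ac)
  show ?case
  proof (cases k)
    case 0
    then show ?thesis using mult_right_mono[of 1 "2 ^ degree p" "norm (coeff p 0)"] by simp
  next
    case (Suc m)
    have "norm (coeff q m) * r ^ k \<le> 2 ^ d * norm (coeff q 0) * r"
      using mult_right_mono[OF IH[of m] assms(1)] by (simp add: Suc mult_ac)
    also have "\<dots> \<le> 2 ^ d * norm (coeff p 0)"
      unfolding c0 using mult_left_mono[OF ra, of "2 ^ d * norm (coeff q 0)"] by (simp add: mult_ac)
    finally have 2: "norm (coeff q m) * r ^ k \<le> 2 ^ d * norm (coeff p 0)" .
    have "coeff p k = coeff q m - a * coeff q k" by (simp add: q Suc)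
    then have "norm (coeff p k) \<le> norm (coeff q m) + norm (a * coeff q k)"
      using norm_triangle_ineq4 by metis
    then have "norm (coeff p k) * r ^ k \<le> (norm (coeff q m) + norm (a * coeff q k)) * r ^ k"
      using assms(1) by (intro mult_right_mono) auto
    also have "\<dots> \<le> 2 * (2 ^ d * norm (coeff p 0))"
      using 1[of k] 2 by (simp add: distrib_right)
    finally show ?thesis using Suc.hyps(2) by (simp flip: Suc.hyps(2))
  qed
qed

lemma ex_small_root:
  fixes R :: "complex poly poly"
  assumes "r > 0" "norm (poly (coeff R 0) t) * 2 ^ degree R < norm (poly (coeff R k) t) * r ^ k"
  shows "\<exists>v. norm v < r \<and> eval2 R t v = 0"
proof (rule ccontr)
  define p where "p = map_poly (\<lambda>q. poly q t) R"
  assume "\<not> ?thesis"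
  then have "norm (coeff p k) * r ^ k \<le> 2 ^ degree p * norm (coeff p 0)"
    using assms(1) by (intro coeff_bound_of_large_roots) (auto simp: eval2_map_poly p_def not_less)
  \<comment> \<open>Specialization may lower the degree; passing to \<open>degree R\<close> makes
    the bound uniform in \<open>t\<close>.\<close>
  also have "\<dots> \<le> 2 ^ degree R * norm (coeff p 0)"
  proof (intro mult_right_mono power_increasing)
    show "degree p \<le> degree R"
      unfolding p_def by (rule degree_le) (simp add: coeff_map_poly coeff_eq_0)
  qed auto
  finally show False using assms(2) by (simp add: p_def coeff_map_poly mult.commute)
qed

text \<open>Continuity of roots: at \<open>t0\<close> the constant coefficient vanishes and some
  other one does not, so the inequality of \<open>ex_small_root\<close> holds strictly there and
  persists nearby.\<close>

lemma nearby_root: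
  assumes "eval2 R t0 0 = 0" "eval2 R t0 v0 \<noteq> 0" "r > 0"
  shows "\<forall>\<^sub>F t in at t0. \<exists>v. norm v < r \<and> eval2 R t v = 0"
proof -
  have 0: "poly (coeff R 0) t0 = 0"
    using assms(1) by (simp add: eval2_map_poly poly_0_coeff_0 coeff_map_poly)
  obtain k where k: "poly (coeff R k) t0 \<noteq> 0"
  proof (rule ccontr)
    assume "\<not> thesis"
    then have "map_poly (\<lambda>q. poly q t0) R = 0"
      using that by (intro poly_eqI) (auto simp: coeff_map_poly)
    then show False using assms(2) by (simp add: eval2_map_poly)
  qed
  have "((\<lambda>t. norm (poly (coeff R 0) t) * 2 ^ degree R) \<longlongrightarrow> norm (poly (coeff R 0) t0) * 2 ^ degree R) (at t0)"
    "((\<lambda>t. norm (poly (coeff R k) t) * r ^ k) \<longlongrightarrow> norm (poly (coeff R k) t0) * r ^ k) (at t0)"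
    by (intro tendsto_intros)+
  from tendsto_diff[OF this(2,1)]
  have "\<forall>\<^sub>F t in at t0. 0 < norm (poly (coeff R k) t) * r ^ k - norm (poly (coeff R 0) t) * 2 ^ degree R"
    by (rule order_tendstoD) (use 0 k assms(3) in auto)
  then have "\<forall>\<^sub>F t in at t0. norm (poly (coeff R 0) t) * 2 ^ degree R < norm (poly (coeff R k) t) * r ^ k"
    by eventually_elim simp
  then show ?thesis by eventually_elim (rule ex_small_root[OF assms(3)])
qed

lemma poly_ratio_converges:
  fixes p q :: "complex poly"
  assumes "p \<noteq> 0" "degree q \<le> degree p"
  shows "\<exists>L. ((\<lambda>x. poly q x / poly p x) \<longlongrightarrow> L) at_infinity"
proof (cases "degree q = degree p")
  case False
  then show ?thesis using poly_divide_tendsto_0_at_infinity[of q p] assms by auto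
next
  case True
  have "((\<lambda>x. (poly q x / x ^ degree q) / (poly p x / x ^ degree p)) \<longlongrightarrow> lead_coeff q / lead_coeff p) at_infinity"
    using assms by (intro tendsto_divide poly_divide_tendsto_aux) auto
  moreover have "\<forall>\<^sub>F x in at_infinity. (x::complex) \<noteq> 0"
    by (rule eventually_not_equal_at_infinity)
  then have "\<forall>\<^sub>F x in at_infinity. (poly q x / x ^ degree q) / (poly p x / x ^ degree p) = poly q x / poly p x"
    by eventually_elim (use True in simp)
  ultimately have "((\<lambda>x. poly q x / poly p x) \<longlongrightarrow> lead_coeff q / lead_coeff p) at_infinity"
    by (rule Lim_transform_eventually)
  then show ?thesis ..
qed

lemma poly_eventually_large:
  fixes p :: "complex poly"
  assumes "degree p > 0" shows "\<forall>\<^sub>F t in at_infinity. norm (poly p t) > B"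
  using filterlim_at_infinity_imp_norm_at_top[OF filterlim_poly_at_infinity[OF assms]]
  unfolding filterlim_at_top_dense by blast

text \<open>
  A root that gets small along one sequence going to infinity forces a coefficient to have larger
  degree than the constant one, and then there is a small root everywhere near infinity.
  This replaces the comparison of Puiseux expansions at infinity.
\<close>

lemma small_roots_near_infinity:
  fixes R :: "complex poly poly" and t v :: "nat \<Rightarrow> complex"
  assumes t: "filterlim t at_infinity sequentially" and v: "v \<longlonglongrightarrow> 0"
    and root: "\<forall>\<^sub>F j in sequentially. eval2 R (t j) (v j) = 0" and r: "r > 0"
  shows "\<forall>\<^sub>F t in at_infinity. \<exists>v. norm v < r \<and> eval2 R t v = 0"
proof (cases "coeff R 0 = 0")
  case True
  then have "eval2 R t 0 = 0" for t by (simp add: eval2_def poly_0_coeff_0)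
  then show ?thesis using r by (intro always_eventually) (metis norm_zero)
next
  case nz: False
  have "\<exists>k. degree (coeff R k) > degree (coeff R 0)"
  proof (rule ccontr)
    assume "\<not> ?thesis"
    then have "\<exists>L. ((\<lambda>x. poly (coeff R k) x / poly (coeff R 0) x) \<longlongrightarrow> L) at_infinity" for k
      using nz by (intro poly_ratio_converges) (auto simp: not_less)
    then obtain L where L: "\<And>k. ((\<lambda>x. poly (coeff R k) x / poly (coeff R 0) x) \<longlongrightarrow> L k) at_infinity"
      by metis
    \<comment> \<open>Divided by its constant coefficient, the equation says that this sum is -1,
      whereas convergent ratios times powers of the null sequence \<open>v\<close> tend to
      0.\<close>
    have "(\<lambda>j. \<Sum>k=1..degree R. poly (coeff R k) (t j) / poly (coeff R 0) (t j) * v j ^ k)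
        \<longlonglongrightarrow> (\<Sum>k=1..degree R. L k * 0 ^ k)"
      by (intro tendsto_sum tendsto_mult tendsto_power v filterlim_compose[OF L t])
    moreover have "(\<Sum>k=1..degree R. L k * 0 ^ k) = 0" by (intro sum.neutral) auto
    moreover have "\<forall>\<^sub>F j in sequentially. poly (coeff R 0) (t j) \<noteq> 0"
    proof -
      obtain b where "\<And>x. poly (coeff R 0) x = 0 \<Longrightarrow> norm x \<le> b"
        using finite_imp_bounded[OF poly_roots_finite[OF nz]] by (auto simp: bounded_iff)
      then have "\<forall>\<^sub>F x in at_infinity. poly (coeff R 0) x \<noteq> 0"
        by (intro eventually_at_infinityI[of "b + 1"]) fastforce
      then show ?thesis using t by (auto simp: filterlim_iff)
    qed
    then have "\<forall>\<^sub>F j in sequentially.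
        (\<Sum>k=1..degree R. poly (coeff R k) (t j) / poly (coeff R 0) (t j) * v j ^ k) = -1"
      using root
    proof eventually_elim
      case (elim j)
      have "0 = eval2 R (t j) (v j)" using elim by simp
      also have "\<dots> = (\<Sum>k\<le>degree R. poly (coeff R k) (t j) * v j ^ k)"
        unfolding eval2_def poly_altdef[of R] by (simp add: poly_sum poly_power)
      also have "\<dots> = poly (coeff R 0) (t j) + (\<Sum>k=1..degree R. poly (coeff R k) (t j) * v j ^ k)"
        by (subst atMost_atLeast0, subst sum.atLeast_Suc_atMost) auto
      finally have "(\<Sum>k=1..degree R. poly (coeff R k) (t j) * v j ^ k) = - poly (coeff R 0) (t j)"
        by (simp add: eq_neg_iff_add_eq_0 add.commute)
      then have "(\<Sum>k=1..degree R. poly (coeff R k) (t j) * v j ^ k) / poly (coeff R 0) (t j) = -1"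
        using elim by simp
      then show ?case by (simp add: sum_divide_distrib)
    qed
    ultimately have "(\<lambda>j. -1 :: complex) \<longlonglongrightarrow> 0" using Lim_transform_eventually by fastforce
    then show False by (simp add: tendsto_const_iff)
  qed
  then obtain k where k: "degree (coeff R k) > degree (coeff R 0)" ..
  have "((\<lambda>x. norm (poly (coeff R 0) x / poly (coeff R k) x)) \<longlongrightarrow> 0) at_infinity"
    using poly_divide_tendsto_0_at_infinity[OF k] by (rule tendsto_norm_zero)
  then have "\<forall>\<^sub>F x in at_infinity. norm (poly (coeff R 0) x / poly (coeff R k) x) < r ^ k / 2 ^ degree R"
    by (rule order_tendstoD) (use r in simp)
  moreover have "\<forall>\<^sub>F x in at_infinity. poly (coeff R k) x \<noteq> 0"
  proof -
    have "\<forall>\<^sub>F x in at_infinity. norm (poly (coeff R k) x) > 0"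
      using k by (intro poly_eventually_large) simp
    then show ?thesis by simp
  qed
  ultimately show ?thesis
  proof eventually_elim
    case (elim x)
    then have "norm (poly (coeff R 0) x) * 2 ^ degree R < norm (poly (coeff R k) x) * r ^ k"
      by (simp add: norm_divide field_simps)
    then show ?case by (rule ex_small_root[OF r])
  qed
qed

text \<open>A point close to Q (t j) has a first coordinate that is only approximately t j ^ n. The
  corrected root t' differs from t by o(t ^ (1 - n)), which changes a polynomial of degree at most n
  by o(1).\<close>

lemma nth_root_shift:
  fixes t x :: "nat \<Rightarrow> complex"
  assumes t: "filterlim t at_infinity sequentially" and x: "(\<lambda>j. x j - t j ^ n) \<longlonglongrightarrow> 0" and n: "n > 0"
  shows "\<exists>t'. filterlim t' at_infinity sequentially \<and> (\<forall>\<^sub>F j in sequentially. t' j ^ n = x j) \<and>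
    (\<forall>q. degree q \<le> n \<longrightarrow> (\<lambda>j. poly q (t' j) - poly q (t j)) \<longlonglongrightarrow> 0)"
proof -
  define e where "e j = (x j - t j ^ n) / t j ^ n" for j
  \<comment> \<open>The branch of the n-th root with value 1 at 1 is differentiable there; it
    selects the root of \<open>x j\<close> next to \<open>t j\<close>.\<close>
  define f :: "complex \<Rightarrow> complex" where "f z = (1 + z) powr (1 / of_nat n)" for z
  define t' where "t' j = t j * f (e j)" for j
  have t0: "\<forall>\<^sub>F j in sequentially. t j \<noteq> 0"
  proof -
    have "\<forall>\<^sub>F x in at_infinity. (x::complex) \<noteq> 0"
      by (rule eventually_not_equal_at_infinity)
    then show ?thesis using t by (auto simp: filterlim_iff)
  qed
  have inv: "(\<lambda>j. inverse (t j)) \<longlonglongrightarrow> 0" using t by (rule filterlim_compose[OF tendsto_inverse_0])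
  have "(\<lambda>j. (x j - t j ^ n) * inverse (t j) ^ n) \<longlonglongrightarrow> 0 * 0 ^ n"
    by (intro tendsto_mult tendsto_power x inv)
  then have e: "e \<longlonglongrightarrow> 0" by (simp add: e_def[abs_def] divide_inverse power_inverse)
  have f_deriv: "\<exists>d. DERIV (\<lambda>z. f z ^ k) 0 :> d" for k
    unfolding f_def by (rule exI, (rule derivative_eq_intros refl | simp)+)
  have f: "(\<lambda>j. f (e j)) \<longlonglongrightarrow> 1"
  proof -
    have "isCont (\<lambda>z. f z ^ 1) 0" using f_deriv[of 1] DERIV_isCont by blast
    then have "isCont f 0" by simp
    then have "(\<lambda>j. f (e j)) \<longlonglongrightarrow> f 0" using e by (rule isCont_tendsto_compose)
    then show ?thesis by (simp add: f_def)
  qed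
  have "filterlim t' at_infinity sequentially"
    unfolding t'_def using tendsto_mult_filterlim_at_infinity[OF f _ t] by (simp add: mult.commute)
  moreover have "\<forall>\<^sub>F j in sequentially. t' j ^ n = x j"
  proof -
    have "\<forall>\<^sub>F j in sequentially. dist (e j) 0 < 1" using e by (rule tendstoD) simp
    then show ?thesis using t0
    proof eventually_elim
      case (elim j)
      then have "1 + e j \<noteq> 0" by (auto simp: add_eq_0_iff)
      then have "f (e j) ^ n = 1 + e j" using n by (simp add: f_def powr_def flip: exp_of_nat_mult)
      then show ?case using elim by (simp add: t'_def power_mult_distrib e_def field_simps)
    qed
  qed
  moreover have "(\<lambda>j. poly q (t' j) - poly q (t j)) \<longlonglongrightarrow> 0" if q: "degree q \<le> n" for q
  proof -
    have mono: "(\<lambda>j. t' j ^ k - t j ^ k) \<longlonglongrightarrow> 0" if k: "k \<le> n" for k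
    proof -
      obtain d where "DERIV (\<lambda>z. f z ^ k) 0 :> d" using f_deriv by blast
      \<comment> \<open>Caratheodory's form of the derivative turns t' ^ k - t ^ k into a convergent
        factor times (x - t ^ n) / t ^ (n - k), and k \<le> n keeps the last factor bounded.\<close>
      then obtain g where g: "\<And>z. f z ^ k - f 0 ^ k = g z * (z - 0)" "isCont g 0"
        unfolding CARAT_DERIV by blast
      have "(\<lambda>j. g (e j)) \<longlonglongrightarrow> g 0" using g(2) e by (rule isCont_tendsto_compose)
      then have "(\<lambda>j. g (e j) * (x j - t j ^ n) * inverse (t j) ^ (n - k)) \<longlonglongrightarrow> g 0 * 0 * 0 ^ (n - k)"
        by (intro tendsto_mult tendsto_power x inv)
      moreover have "\<forall>\<^sub>F j in sequentially. g (e j) * (x j - t j ^ n) * inverse (t j) ^ (n - k) = t' j ^ k - t j ^ k"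
        using t0
      proof eventually_elim
        case (elim j)
        have "t' j ^ k - t j ^ k = t j ^ k * (f (e j) ^ k - 1)"
          by (simp add: t'_def power_mult_distrib algebra_simps)
        also have "f (e j) ^ k - 1 = g (e j) * e j" using g(1)[of "e j"] by (simp add: f_def)
        also have "t j ^ k * (g (e j) * e j) = g (e j) * (x j - t j ^ n) * (t j ^ k / t j ^ n)"
          by (simp add: e_def)
        also have "t j ^ k / t j ^ n = inverse (t j) ^ (n - k)"
          using elim k by (simp add: power_diff divide_inverse power_inverse)
        finally show ?case by simp
      qed
      ultimately show ?thesis using Lim_transform_eventually by fastforce
    qed
    have "(\<lambda>j. \<Sum>k\<le>degree q. coeff q k * (t' j ^ k - t j ^ k)) \<longlonglongrightarrow> (\<Sum>k\<le>degree q. coeff q k * 0)"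
      using q by (intro tendsto_intros mono) auto
    then show ?thesis by (simp add: poly_altdef right_diff_distrib sum_subtractf)
  qed
  ultimately show ?thesis by blast
qed

lemma conjugate_roots:
  fixes P :: "complex poly poly" and t x w :: "nat \<Rightarrow> complex"
  assumes P: "P \<noteq> 0" and n: "n > 0" and q: "degree q \<le> n"
    and conj: "\<And>\<xi>. \<xi> ^ n = 1 \<Longrightarrow> \<xi> \<noteq> 1 \<Longrightarrow> pcompose q [:0, \<xi>:] \<noteq> q"
    and t: "filterlim t at_infinity sequentially"
    and x: "(\<lambda>j. x j - t j ^ n) \<longlonglongrightarrow> 0" and w: "(\<lambda>j. w j - poly q (t j)) \<longlonglongrightarrow> 0"
    and root: "\<And>j. eval2 P (x j) (w j) = 0"
  shows "\<forall>\<^sub>F t in at_infinity. \<exists>W. card W = n \<and> (\<forall>w\<in>W. eval2 P (t ^ n) w = 0)"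
proof -
  obtain t' where t': "filterlim t' at_infinity sequentially" "\<forall>\<^sub>F j in sequentially. t' j ^ n = x j"
      "(\<lambda>j. poly q (t' j) - poly q (t j)) \<longlonglongrightarrow> 0"
    using nth_root_shift[OF t x n] q by blast
  have "(\<lambda>u. eval2 P (fst u ^ n) (poly q (fst u) + snd u)) \<in> polyfuns {fst, snd}"
    by (intro polyfun polyfuns.gen) auto
  from polyfuns_2[OF this] obtain R where R: "\<And>t v. eval2 R t v = eval2 P (t ^ n) (poly q t + v)"
    by auto
  \<comment> \<open>The radius 1 matches the separation 2 below: the unit discs around the values q
    (\<zeta> * t) become disjoint.\<close>
  have "\<forall>\<^sub>F t in at_infinity. \<exists>v. norm v < 1 \<and> eval2 R t v = 0"
  proof (rule small_roots_near_infinity[OF t'(1)])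
    show "(\<lambda>j. w j - poly q (t' j)) \<longlonglongrightarrow> 0"
      using tendsto_diff[OF w t'(3)] by simp
    show "\<forall>\<^sub>F j in sequentially. eval2 R (t' j) (w j - poly q (t' j)) = 0"
      using t'(2) by eventually_elim (simp add: R root)
  qed simp
  then obtain b where b: "\<And>t. norm t \<ge> b \<Longrightarrow> \<exists>v. norm v < 1 \<and> eval2 R t v = 0"
    unfolding eventually_at_infinity by blast
  define Z where "Z = {\<zeta>::complex. \<zeta> ^ n = 1}"
  have Z: "finite Z" "card Z = n" unfolding Z_def
    using n by (auto simp: finite_roots_unity card_complex_roots_unity Suc_le_eq)
  have sep: "\<forall>\<^sub>F t in at_infinity. norm (poly q (\<zeta> * t) - poly q (\<xi> * t)) > 2"
    if "\<zeta> \<in> Z" "\<xi> \<in> Z" "\<zeta> \<noteq> \<xi>" for \<zeta> \<xi>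
  proof -
    \<comment> \<open>\<open>u\<close> is nonconstant: its constant term is 0, and u = 0 would,
      after rescaling by 1 / \<xi>, contradict \<open>conj\<close> for \<zeta> / \<xi>.\<close>
    define u where "u = pcompose q [:0, \<zeta>:] - pcompose q [:0, \<xi>:]"
    have \<xi>: "\<xi> \<noteq> 0" using that n by (auto simp: Z_def power_0_left)
    have "u \<noteq> 0"
    proof
      assume "u = 0"
      then have "pcompose (pcompose q [:0, \<zeta>:]) [:0, inverse \<xi>:] = pcompose (pcompose q [:0, \<xi>:]) [:0, inverse \<xi>:]"
        by (simp add: u_def)
      then have "pcompose q [:0, \<zeta> / \<xi>:] = q"
        using \<xi> by (simp add: pcompose_pCons divide_inverse mult.commute flip: pcompose_assoc)
      moreover have "(\<zeta> / \<xi>) ^ n = 1" "\<zeta> / \<xi> \<noteq> 1"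
        using that \<xi> by (auto simp: Z_def power_divide)
      ultimately show False using conj by blast
    qed
    moreover have "coeff u 0 = 0" by (simp add: u_def flip: poly_0_coeff_0, simp add: poly_pcompose)
    ultimately have "degree u > 0" by (metis degree_eq_zeroE coeff_pCons_0 gr_zeroI pCons_0_0)
    then have "\<forall>\<^sub>F t in at_infinity. norm (poly u t) > 2" by (rule poly_eventually_large)
    then show ?thesis by (simp add: u_def poly_pcompose mult.commute)
  qed
  have "\<forall>\<^sub>F t in at_infinity. \<forall>\<zeta>\<in>Z. \<forall>\<xi>\<in>Z. \<zeta> \<noteq> \<xi> \<longrightarrow> norm (poly q (\<zeta> * t) - poly q (\<xi> * t)) > 2"
    using sep by (intro eventually_ball_finite Z ballI) (auto intro!: eventually_mono[OF sep])
  moreover have "\<forall>\<^sub>F t in at_infinity. norm (t::complex) \<ge> b"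
    by (auto simp: eventually_at_infinity)
  ultimately show ?thesis
  proof eventually_elim
    case (elim t)
    have "\<exists>v. norm v < 1 \<and> eval2 R (\<zeta> * t) v = 0" if "\<zeta> \<in> Z" for \<zeta>
    proof (rule b)
      have "norm \<zeta> = 1" using that n power_eq_1_iff[of \<zeta> n] by (simp add: Z_def)
      then show "norm (\<zeta> * t) \<ge> b" using elim(2) by (simp add: norm_mult)
    qed
    then obtain v where v: "\<And>\<zeta>. \<zeta> \<in> Z \<Longrightarrow> norm (v \<zeta>) < 1 \<and> eval2 R (\<zeta> * t) (v \<zeta>) = 0" by metis
    have "inj_on (\<lambda>\<zeta>. poly q (\<zeta> * t) + v \<zeta>) Z"
    proof (rule inj_onI, rule ccontr)
      fix \<zeta> \<xi> assume *: "\<zeta> \<in> Z" "\<xi> \<in> Z" "poly q (\<zeta> * t) + v \<zeta> = poly q (\<xi> * t) + v \<xi>" "\<zeta> \<noteq> \<xi>"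
      have "poly q (\<zeta> * t) - poly q (\<xi> * t) = v \<xi> - v \<zeta>"
        using *(3) by (simp add: algebra_simps)
      then have "norm (poly q (\<zeta> * t) - poly q (\<xi> * t)) = norm (v \<xi> - v \<zeta>)" by simp
      also have "\<dots> < 2" using norm_triangle_ineq4[of "v \<xi>" "v \<zeta>"] v[OF *(1)] v[OF *(2)] by linarith
      finally show False using elim * by fastforce
    qed
    then have "card ((\<lambda>\<zeta>. poly q (\<zeta> * t) + v \<zeta>) ` Z) = n" using Z by (simp add: card_image)
    moreover have "eval2 P (t ^ n) (poly q (\<zeta> * t) + v \<zeta>) = 0" if "\<zeta> \<in> Z" for \<zeta>
      using v[OF that] that by (simp add: R power_mult_distrib Z_def)
    ultimately show ?case by blast
  qed
qed

text \<open>The line x = s is tilted to x = s - \<eta> * w. Since \<open>nz\<close> keeps P from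
  vanishing on the whole line x = s, the roots over \<open>s\<close> move continuously, stay
  distinct and keep their abscissas off \<open>S\<close>.\<close>

lemma perturbed_roots:
  fixes P :: "complex poly poly"
  assumes S: "finite S" "s \<notin> S" and W: "finite W" "\<And>w. w \<in> W \<Longrightarrow> eval2 P s w = 0"
    and nz: "eval2 P s u \<noteq> 0"
  shows "\<forall>\<^sub>F \<eta> in at 0. \<exists>W'. card W' = card W \<and> (\<forall>w\<in>W'. s - \<eta> * w \<notin> S \<and> eval2 P (s - \<eta> * w) w = 0)"
proof -
  have "\<forall>\<^sub>F r in at_right 0. \<forall>w\<in>W. \<forall>w'\<in>W. w \<noteq> w' \<longrightarrow> 2 * r \<le> dist w w'"
  proof (intro eventually_ball_finite W ballI)
    fix w w' show "\<forall>\<^sub>F r in at_right 0. w \<noteq> w' \<longrightarrow> 2 * r \<le> dist w w'"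
    proof (cases "w = w'")
      case False
      then have "\<forall>\<^sub>F r in at_right 0. r < dist w w' / 2"
        by (intro eventually_at_right_less eventually_at_rightI[of 0 "dist w w' / 2"]) auto
      then show ?thesis by eventually_elim auto
    qed simp
  qed
  moreover have "\<forall>\<^sub>F r::real in at_right 0. r > 0" by (rule eventually_at_right_less)
  ultimately have "\<forall>\<^sub>F r in at_right 0. r > 0 \<and> (\<forall>w\<in>W. \<forall>w'\<in>W. w \<noteq> w' \<longrightarrow> 2 * r \<le> dist w w')"
    by eventually_elim auto
  then obtain r where r: "r > 0" "\<And>w w'. w \<in> W \<Longrightarrow> w' \<in> W \<Longrightarrow> w \<noteq> w' \<Longrightarrow> 2 * r \<le> dist w w'"
    using eventually_happens'[OF trivial_limit_at_right_real] by blast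
  obtain d where d: "d > 0" "\<And>\<sigma>. \<sigma> \<in> S \<Longrightarrow> d \<le> dist s \<sigma>"
    using finite_set_avoid[OF S(1), of s] S(2) by metis
  \<comment> \<open>The middle condition keeps the shift \<eta> * (w + v) of the abscissa below
    \<open>d\<close>, a lower bound for the distance from \<open>s\<close> to
    \<open>S\<close>.\<close>
  have "\<forall>\<^sub>F \<eta> in at 0. \<forall>w\<in>W. \<exists>v. norm v < r \<and> norm \<eta> * (norm w + r) < d \<and> eval2 P (s - \<eta> * (w + v)) (w + v) = 0"
  proof (intro eventually_ball_finite W ballI)
    fix w assume w: "w \<in> W"
    have "(\<lambda>p. eval2 P (s - fst p * (w + snd p)) (w + snd p)) \<in> polyfuns {fst, snd}"
      by (intro polyfun polyfuns.gen) auto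
    from polyfuns_2[OF this] obtain R where R: "\<And>\<eta> v. eval2 R \<eta> v = eval2 P (s - \<eta> * (w + v)) (w + v)"
      by auto
    have "\<forall>\<^sub>F \<eta> in at 0. \<exists>v. norm v < r \<and> eval2 R \<eta> v = 0"
      \<comment> \<open>At \<eta> = 0 the offset u - w gives the value of P at (s, u), nonzero by
        \<open>nz\<close>.\<close>
      by (rule nearby_root[where ?v0.0 = "u - w"]) (use W w nz r in \<open>auto simp: R\<close>)
    moreover have "((\<lambda>\<eta>::complex. norm \<eta> * (norm w + r)) \<longlongrightarrow> norm (0::complex) * (norm w + r)) (at 0)"
      by (intro tendsto_mult tendsto_const tendsto_norm tendsto_ident_at)
    then have "\<forall>\<^sub>F \<eta>::complex in at 0. norm \<eta> * (norm w + r) < d"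
      by (rule order_tendstoD) (use d in simp)
    ultimately show "\<forall>\<^sub>F \<eta> in at 0. \<exists>v. norm v < r \<and> norm \<eta> * (norm w + r) < d \<and>
        eval2 P (s - \<eta> * (w + v)) (w + v) = 0"
      by eventually_elim (auto simp: R)
  qed
  then show ?thesis
  proof eventually_elim
    case (elim \<eta>)
    then obtain v where v: "\<And>w. w \<in> W \<Longrightarrow> norm (v w) < r \<and> norm \<eta> * (norm w + r) < d \<and>
        eval2 P (s - \<eta> * (w + v w)) (w + v w) = 0"
      by metis
    have "inj_on (\<lambda>w. w + v w) W"
    proof (rule inj_onI, rule ccontr)
      fix w w' assume *: "w \<in> W" "w' \<in> W" "w + v w = w' + v w'" "w \<noteq> w'"
      have "w - w' = v w' - v w" using *(3) by (simp add: algebra_simps)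
      then have "dist w w' = norm (v w' - v w)" by (simp add: dist_norm)
      also have "\<dots> < 2 * r" using norm_triangle_ineq4[of "v w'" "v w"] v[OF *(1)] v[OF *(2)] by linarith
      finally show False using r(2)[OF *(1,2,4)] by simp
    qed
    then have "card ((\<lambda>w. w + v w) ` W) = card W" by (simp add: card_image)
    moreover have "s - \<eta> * (w + v w) \<notin> S" if w: "w \<in> W" for w
    proof
      assume "s - \<eta> * (w + v w) \<in> S"
      then have "d \<le> norm (\<eta> * (w + v w))" using d(2) by (fastforce simp: dist_norm)
      also have "\<dots> \<le> norm \<eta> * (norm w + r)" unfolding norm_mult
        using v[OF w] norm_triangle_ineq[of w "v w"] by (intro mult_left_mono) auto
      also have "\<dots> < d" using v[OF w] by blast
      finally show False by simp
    qed
    ultimately show ?case using v by (intro exI[of _ "(\<lambda>w. w + v w) ` W"]) auto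
  qed
qed

section \<open>Polynomially parametrized curves\<close>

text \<open>Otherwise all n roots of unity of order dividing n would satisfy an equation of the
  smaller positive degree k mod n.\<close>

lemma power_eq_1_all_roots_dvd:
  assumes "n > 0" "\<And>\<zeta>::complex. \<zeta> ^ n = 1 \<Longrightarrow> \<zeta> ^ k = 1" shows "n dvd k"
proof (rule ccontr)
  assume "\<not> n dvd k"
  then have r: "0 < k mod n" "k mod n < n" using assms(1) by (auto simp: dvd_eq_mod_eq_0)
  have "\<zeta> ^ (k mod n) = 1" if "\<zeta> ^ n = 1" for \<zeta> :: complex
  proof -
    have "\<zeta> ^ k = (\<zeta> ^ n) ^ (k div n) * \<zeta> ^ (k mod n)"
      by (simp flip: power_mult power_add)
    then show ?thesis using assms(2)[OF that] that by simp
  qed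
  then have "card {\<zeta>::complex. \<zeta> ^ n = 1} \<le> card {\<zeta>::complex. \<zeta> ^ (k mod n) = 1}"
    using r by (intro card_mono finite_roots_unity) auto
  then show False using r assms(1) by (simp add: card_roots_unity_eq)
qed

text \<open>Substituting \<zeta> * t multiplies the coefficient of t ^ k by \<zeta> ^ k, so
  invariance kills every exponent not divisible by n.\<close>

lemma poly_in_nth_power:
  fixes E :: "complex poly poly"
  assumes n: "n > 0" and inv: "\<And>u t \<zeta>. \<zeta> ^ n = 1 \<Longrightarrow> eval2 E u (\<zeta> * t) = eval2 E u t"
  shows "\<exists>E'. \<forall>u t. eval2 E' u (t ^ n) = eval2 E u t"
proof -
  have coeff: "coeff E k = 0" if k: "\<not> n dvd k" for k
  proof -
    obtain \<zeta> :: complex where \<zeta>: "\<zeta> ^ n = 1" "\<zeta> ^ k \<noteq> 1"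
      using power_eq_1_all_roots_dvd[OF n, of k] k by auto
    have "eval2 (pcompose E [:0, [:\<zeta>:]:] - E) u t = 0" for u t
      using inv[OF \<zeta>(1), of u t] by (simp add: eval2_def poly_pcompose mult.commute)
    then have "pcompose E [:0, [:\<zeta>:]:] = E"
      by (metis right_minus_eq ex_eval2_nonzero)
    then have "[:\<zeta>:] ^ k * coeff E k = 1 * coeff E k"
      using coeff_pcompose_linear[of E "[:\<zeta>:]" k] by simp
    moreover have "[:\<zeta>:] ^ k \<noteq> 1"
    proof
      assume "[:\<zeta>:] ^ k = 1"
      from arg_cong[OF this, of "\<lambda>p. poly p 0"] show False using \<zeta>(2) by (simp add: poly_power)
    qed
    ultimately show ?thesis by (simp only: mult_cancel_right) simp
  qed
  define E' where "E' = (\<Sum>k\<le>degree E. monom (coeff E (n * k)) k)"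
  have "eval2 E' u (t ^ n) = eval2 E u t" for u t
  proof -
    have "eval2 E u t = (\<Sum>k\<le>degree E. poly (coeff E k) u * t ^ k)"
      unfolding eval2_def poly_altdef[of E] by (simp add: poly_sum poly_power)
    also have "\<dots> = (\<Sum>k\<le>n * degree E. poly (coeff E k) u * t ^ k)"
      using n by (intro sum.mono_neutral_left) (auto simp: coeff_eq_0 not_le)
    also have "\<dots> = (\<Sum>k\<in>(\<lambda>k. n * k) ` {..degree E}. poly (coeff E k) u * t ^ k)"
    proof (intro sum.mono_neutral_right)
      show "\<forall>i\<in>{..n * degree E} - (*) n ` {..degree E}. poly (coeff E i) u * t ^ i = 0"
      proof
        fix i assume i: "i \<in> {..n * degree E} - (*) n ` {..degree E}"
        then have "\<not> n dvd i" using n by (auto elim!: dvdE)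
        then show "poly (coeff E i) u * t ^ i = 0" using coeff by simp
      qed
    qed auto
    also have "\<dots> = (\<Sum>k\<le>degree E. poly (coeff E (n * k)) u * t ^ (n * k))"
      using n by (subst sum.reindex) (auto simp: inj_on_def)
    also have "\<dots> = eval2 E' u (t ^ n)"
      unfolding E'_def eval2_def by (simp add: poly_sum poly_monom poly_power power_mult)
    finally show ?thesis ..
  qed
  then show ?thesis by blast
qed

text \<open>Stand-in for the resultant of \<open>f\<close> and \<open>g\<close>. If their ideal
  contained no nonzero element free of t, an element of least degree would yield a common root
  wherever its leading coefficient is nonzero, against \<open>generic\<close> for this
  coefficient.\<close>

lemma elimination_ideal:
  fixes f g :: "complex poly4 poly"
  assumes nz: "f \<noteq> 0"
    and generic: "\<And>G. G \<noteq> 0 \<Longrightarrow> \<exists>a b c e. eval4 G a b c e \<noteq> 0 \<and>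
      (\<forall>t. \<not> (poly (map_poly (\<lambda>F. eval4 F a b c e) f) t = 0 \<and> poly (map_poly (\<lambda>F. eval4 F a b c e) g) t = 0))"
  shows "\<exists>F. F \<noteq> 0 \<and> (\<forall>a b c e. eval4 F a b c e \<noteq> 0 \<longrightarrow>
      (\<forall>t. \<not> (poly (map_poly (\<lambda>F. eval4 F a b c e) f) t = 0 \<and> poly (map_poly (\<lambda>F. eval4 F a b c e) g) t = 0)))"
proof -
  interpret at4: hom_to_complex "\<lambda>F. eval4 F a b c e" for a b c e
    by unfold_locales auto
  define J where "J = {u * f + v * g | u v. True}"
  have J: "is_ideal J" unfolding is_ideal_def
  proof (intro conjI ballI allI)
    have "0 * f + 0 * g \<in> J" unfolding J_def by blast
    then show "0 \<in> J" by simp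
  next
    fix p q assume "p \<in> J" "q \<in> J"
    then obtain u v u' v' where "p = u * f + v * g" "q = u' * f + v' * g" unfolding J_def by blast
    then have "p + q = (u + u') * f + (v + v') * g" by (simp add: algebra_simps)
    then show "p + q \<in> J" unfolding J_def by blast
  next
    fix p h assume "p \<in> J"
    then obtain u v where "p = u * f + v * g" unfolding J_def by blast
    then have "h * p = (h * u) * f + (h * v) * g" by (simp add: algebra_simps)
    then show "h * p \<in> J" unfolding J_def by blast
  qed
  have "1 * f + 0 * g \<in> J" "0 * f + 1 * g \<in> J" unfolding J_def by blast+
  then have fg: "f \<in> J" "g \<in> J" by simp_all
  have "\<exists>F. F \<noteq> 0 \<and> [:F:] \<in> J"
  proof (rule ccontr)
    assume "\<not> ?thesis"
    then have const: "\<And>F. [:F:] \<in> J \<Longrightarrow> F = 0" by blast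
    obtain d where d: "d \<in> J" "d \<noteq> 0" and least: "\<And>p. p \<in> J \<Longrightarrow> p \<noteq> 0 \<Longrightarrow> degree d \<le> degree p"
      using ex_least_degree[of J "\<lambda>p. p \<noteq> 0"] nz fg by metis
    have 1: "[:lead_coeff d:] \<notin> J" using const d by fastforce
    have 2: "p \<noteq> 0" if "[:lead_coeff p:] \<notin> J" for p using that J by (auto simp: is_ideal_def)
    obtain a b c e where abce: "eval4 (lead_coeff d) a b c e \<noteq> 0"
      "\<And>t. \<not> (poly (map_poly (\<lambda>F. eval4 F a b c e) f) t = 0 \<and> poly (map_poly (\<lambda>F. eval4 F a b c e) g) t = 0)"
      using generic[of "lead_coeff d"] d(2) by auto
    have "\<exists>t. \<forall>p\<in>J. poly (map_poly (\<lambda>F. eval4 F a b c e) p) t = 0"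
    proof (rule at4.common_root_least_degree[OF J d(1) 1 _ _ abce(1)])
      show "degree d \<le> degree p" if "p \<in> J" "[:lead_coeff p:] \<notin> J" for p using least 2 that by blast
      show "eval4 F a b c e = 0" if "[:F:] \<in> J" for F using const[OF that] by simp
    qed
    then show False using fg abce(2) by blast
  qed
  then obtain F u v where F: "F \<noteq> 0" "[:F:] = u * f + v * g" unfolding J_def by blast
  have "eval4 F a b c e = 0" if "poly (map_poly (\<lambda>F. eval4 F a b c e) f) t = 0"
    "poly (map_poly (\<lambda>F. eval4 F a b c e) g) t = 0" for a b c e t
  proof -
    have "poly (map_poly (\<lambda>F. eval4 F a b c e) [:F:]) t = 0" unfolding F(2) using that by simp
    then show ?thesis by (simp add: map_poly_pCons)
  qed
  then show ?thesis using F(1) by blast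
qed

text \<open>\<open>primitive\<close> says that the parametrization is proper: for an n-th root of
  unity \<xi> other than 1, t and \<xi> * t do not have the same image identically in t.\<close>

locale param_curve =
  fixes n :: nat and p2 p3 :: "complex poly"
  assumes n: "n > 0" and degree_le: "degree p2 \<le> n" "degree p3 \<le> n"
    and primitive: "\<And>\<xi>. \<xi> ^ n = 1 \<Longrightarrow> pcompose p2 [:0, \<xi>:] = p2 \<Longrightarrow> pcompose p3 [:0, \<xi>:] = p3 \<Longrightarrow> \<xi> = 1"
begin

definition Q :: "complex \<Rightarrow> point3" where "Q t = (t ^ n, poly p2 t, poly p3 t)"

section \<open>Closedness, irreducibility and dimension of the image\<close>

lemma ex_Q: "\<exists>t. fst (Q t) = x"
proof -
  have "\<not> constant (poly (monom 1 n + [:- x:]))"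
    unfolding constant_degree by (subst degree_add_eq_left) (use n in \<open>auto simp: degree_monom_eq\<close>)
  then obtain t where "poly (monom 1 n + [:- x:]) t = 0"
    using Fundamental_Theorem_Algebra.fundamental_theorem_of_algebra by blast
  then show ?thesis by (auto simp: Q_def poly_monom)
qed

lemma same_power_conj:
  assumes "s ^ n = (t::complex) ^ n" shows "\<exists>\<zeta>. \<zeta> ^ n = 1 \<and> s = \<zeta> * t"
proof (cases "t = 0")
  case True
  then show ?thesis using assms n by (auto simp: power_0_left intro: exI[of _ 1])
next
  case False
  then show ?thesis using assms by (intro exI[of _ "s / t"]) (auto simp: power_divide)
qed

lemma polyfuns_Q: "(\<lambda>t. eval3 g (Q t)) \<in> polyfuns {\<lambda>t. t}"
  unfolding Q_def by (intro polyfun polyfuns.gen) auto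

lemma finite_Q_zeros: "eval3 g (Q t0) \<noteq> 0 \<Longrightarrow> finite {t. eval3 g (Q t) = 0}"
  using polyfuns_finite_zeros[OF polyfuns_Q] .

lemma infinite_range_Q: "infinite (range Q)"
proof
  assume "finite (range Q)"
  then have "finite (fst ` range Q)" by blast
  moreover have "fst ` range Q = UNIV" using ex_Q by (metis (no_types) UNIV_eq_I image_eqI rangeI)
  ultimately show False using infinite_UNIV_char_0[where ?'a = complex] by simp
qed

text \<open>
  The norm of \<open>p2 + k * p3 - u\<close> from \<open>\<complex>[t, u]\<close> down to \<open>\<complex>[t\<^sup>n, u]\<close> gives an equation of the
  curve; \<open>k\<close> is chosen such that it separates a given point from the finitely many points of the
  curve with the same first coordinate.
\<close>

lemma algebraic_range_Q: "algebraic (range Q)"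
proof -
  have "zariski_closure (range Q) \<subseteq> range Q"
  proof (rule subsetI, rule ccontr)
    fix p assume p: "p \<in> zariski_closure (range Q)" "p \<notin> range Q"
    obtain x y z where xyz: "p = (x, y, z)" by (cases p)
    obtain t0 where t0: "t0 ^ n = x" using ex_Q[of x] by (auto simp: Q_def)
    define Z where "Z = {\<zeta>::complex. \<zeta> ^ n = 1}"
    have Z: "finite Z" unfolding Z_def using n by (intro finite_roots_unity) simp
    have "finite (\<Union>\<zeta>\<in>Z. {k. poly p2 (\<zeta> * t0) - y + k * (poly p3 (\<zeta> * t0) - z) = 0})"
    proof (intro finite_UN_I Z)
      fix \<zeta> assume \<zeta>: "\<zeta> \<in> Z"
      have "Q (\<zeta> * t0) \<noteq> p" using p(2) by blast
      then have "[:poly p2 (\<zeta> * t0) - y, poly p3 (\<zeta> * t0) - z:] \<noteq> 0"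
        using \<zeta> t0 by (auto simp: Q_def xyz Z_def power_mult_distrib)
      then show "finite {k. poly p2 (\<zeta> * t0) - y + k * (poly p3 (\<zeta> * t0) - z) = 0}"
        by (rule finite_subset[OF _ poly_roots_finite, rotated]) auto
    qed
    then obtain k where k: "\<And>\<zeta>. \<zeta> \<in> Z \<Longrightarrow> poly p2 (\<zeta> * t0) - y + k * (poly p3 (\<zeta> * t0) - z) \<noteq> 0"
      using ex_avoiding_finite by blast
    define N where "N u t = (\<Prod>\<zeta>\<in>Z. poly p2 (\<zeta> * t) + k * poly p3 (\<zeta> * t) - u)" for u t
    have "(\<lambda>p. \<Prod>\<zeta>\<in>A. poly p2 (\<zeta> * snd p) + k * poly p3 (\<zeta> * snd p) - fst p) \<in> polyfuns {fst, snd}"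
      if "finite A" for A using that
    proof induction
      case empty show ?case by (simp add: polyfuns.const)
    next
      case (insert \<zeta> A)
      show ?case unfolding prod.insert[OF insert.hyps]
        by (intro polyfun insert.IH polyfuns.gen) auto
    qed
    from polyfuns_2[OF this[OF Z]] obtain E where E: "\<And>u t. eval2 E u t = N u t" by (auto simp: N_def)
    have "N u (\<zeta> * t) = N u t" if \<zeta>: "\<zeta> ^ n = 1" for u t \<zeta>
      unfolding N_def
    proof (rule prod.reindex_bij_witness[of _ "\<lambda>\<xi>. \<xi> / \<zeta>" "\<lambda>\<xi>. \<xi> * \<zeta>"])
    qed (use \<zeta> n in \<open>auto simp: Z_def power_mult_distrib power_divide mult.assoc power_0_left\<close>)
    then obtain E' where E': "\<And>u t. eval2 E' u (t ^ n) = N u t"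
      using poly_in_nth_power[OF n, of E] by (auto simp: E)
    have "(\<lambda>p. eval2 E' ((fst \<circ> snd) p + k * (snd \<circ> snd) p) (fst p)) \<in> polyfuns {fst, fst \<circ> snd, snd \<circ> snd}"
      by (intro polyfun polyfuns.gen) auto
    from polyfuns_3[OF this] obtain g where g: "\<And>x y z. eval3 g (x, y, z) = eval2 E' (y + k * z) x"
      by auto
    have "eval3 g (Q t) = 0" for t
    proof -
      have "1 \<in> Z" by (simp add: Z_def)
      then have "N (poly p2 t + k * poly p3 t) t = 0" unfolding N_def using Z by (auto intro!: bexI[of _ 1])
      then show ?thesis by (simp add: Q_def g E')
    qed
    then have "eval3 g p = 0" using p(1) by (auto simp: zariski_closure_def zero_set_def)
    then have "N (y + k * z) t0 = 0" using E'[of "y + k * z" t0] by (simp add: xyz g t0)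
    then obtain \<zeta> where "\<zeta> \<in> Z" "poly p2 (\<zeta> * t0) + k * poly p3 (\<zeta> * t0) - (y + k * z) = 0"
      unfolding N_def using Z by auto
    then show False using k[of \<zeta>] by (simp add: algebra_simps)
  qed
  then show ?thesis using subset_zariski_closure algebraic_zariski_closure by (metis subset_antisym)
qed

text \<open>An equation of \<open>V\<close> that fails somewhere on the curve pulls back to a
  nonzero polynomial in t. Irreducibility and dimension one both rest on this.\<close>

lemma finite_proper_subset:
  assumes "algebraic V" "V \<subset> range Q" shows "finite V"
proof -
  obtain t0 where "Q t0 \<notin> V" using assms(2) by blast
  then obtain g where g: "g \<in> vanishing V" "eval3 g (Q t0) \<noteq> 0"
    using algebraic_memI[OF assms(1)] by blast
  have "V \<subseteq> Q ` {t. eval3 g (Q t) = 0}" using assms(2) g(1) by (auto simp: vanishing_def)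
  then show ?thesis using finite_Q_zeros[OF g(2)] by (meson finite_imageI finite_subset)
qed

lemma irreducible_range_Q: "irreducible_algebraic (range Q)"
  unfolding irreducible_algebraic_def
proof (intro conjI allI impI algebraic_range_Q)
  fix V1 V2 assume *: "algebraic V1 \<and> algebraic V2 \<and> range Q = V1 \<union> V2"
  then have "infinite V1 \<or> infinite V2" using infinite_range_Q by (metis finite_Un)
  then show "range Q = V1 \<or> range Q = V2" using * finite_proper_subset by (metis Un_upper1 Un_upper2 psubsetI)
qed auto

lemma alg_dim_range_Q: "alg_dim (range Q) = 1"
proof (rule antisym)
  have "k \<le> 1" if Z: "\<And>i. i \<le> k \<Longrightarrow> irreducible_algebraic (Z i) \<and> Z i \<subseteq> range Q"
    "\<And>i. i < k \<Longrightarrow> Z i \<subset> Z (Suc i)" for k and Z :: "nat \<Rightarrow> point3 set"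
  proof (rule ccontr)
    assume "\<not> k \<le> 1"
    then have k: "0 < k" "1 < k" by auto
    \<comment> \<open>The middle term of a chain of length two would be finite and irreducible,
      hence a point, with no irreducible set strictly below it.\<close>
    have "Z 1 \<subset> range Q" using Z(1)[of 2] Z(2)[of 1] k by (auto simp: numeral_2_eq_2)
    then have "finite (Z 1)" using finite_proper_subset Z(1)[of 1] k by (auto simp: irreducible_algebraic_def)
    then obtain p where "Z 1 = {p}" using irreducible_finite Z(1)[of 1] k by (metis less_imp_le)
    then have "Z 0 = {}" using Z(2)[of 0] k by auto
    then show False using Z(1)[of 0] by (auto simp: irreducible_algebraic_def)
  qed
  then show "alg_dim (range Q) \<le> 1"
    unfolding alg_dim_def one_enat_def by (intro Sup_least) (clarsimp, metis One_nat_def)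
  have "enat 1 \<in> {enat n | n. \<exists>Z :: nat \<Rightarrow> point3 set.
     (\<forall>i\<le>n. irreducible_algebraic (Z i) \<and> Z i \<subseteq> range Q) \<and> (\<forall>i<n. Z i \<subset> Z (Suc i))}"
  proof (intro CollectI exI[of _ 1] exI[of _ "\<lambda>i. if i = 0 then {Q 0} else range Q"] conjI allI impI refl)
    fix i :: nat assume "i < 1"
    have "range Q \<noteq> {Q 0}" using infinite_range_Q by (metis finite.emptyI finite.insertI)
    then show "(if i = 0 then {Q 0} else range Q) \<subset> (if Suc i = 0 then {Q 0} else range Q)"
      using \<open>i < 1\<close> by auto
  qed (auto simp: irreducible_singleton irreducible_range_Q)
  then show "1 \<le> alg_dim (range Q)"
    unfolding alg_dim_def by (intro Sup_upper) (simp add: one_enat_def)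
qed

lemma irreducible_curve_range_Q: "irreducible_curve (range Q)"
  by (simp add: irreducible_curve_def irreducible_range_Q alg_dim_range_Q)

text \<open>Infinitely many common parameters force \<open>range Q\<close> into \<open>D\<close>; a
  proper inclusion would give the chain \<open>{Q 0}\<close>, \<open>range Q\<close>,
  \<open>D\<close> of length two.\<close>

lemma irreducible_curve_unique:
  assumes D: "irreducible_curve D" and T: "infinite T" "Q ` T \<subseteq> D" shows "D = range Q"
proof (rule ccontr)
  assume neq: "D \<noteq> range Q"
  have D': "irreducible_algebraic D" "algebraic D" "alg_dim D = 1"
    using D by (auto simp: irreducible_curve_def irreducible_algebraic_def)
  have "range Q \<subseteq> D"
  proof
    fix p assume "p \<in> range Q"
    then obtain t0 where t0: "p = Q t0" by blast
    show "p \<in> D"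
    proof (rule algebraic_memI[OF D'(2)], rule ccontr)
      fix g assume g: "g \<in> vanishing D" "eval3 g p \<noteq> 0"
      have "T \<subseteq> {t. eval3 g (Q t) = 0}" using g(1) T(2) by (auto simp: vanishing_def)
      then show False using finite_Q_zeros[of g t0] g(2) t0 T(1) finite_subset by blast
    qed
  qed
  then have sub: "range Q \<subset> D" using neq by blast
  define Z where "Z = (\<lambda>i::nat. if i = 0 then {Q 0} else if i = 1 then range Q else D)"
  have "range Q \<noteq> {Q 0}" using infinite_range_Q by (metis finite.emptyI finite.insertI)
  then have "{Q 0} \<subset> range Q" by blast
  then have "\<forall>i<2. Z i \<subset> Z (Suc i)" using sub by (auto simp: Z_def less_2_cases_iff)
  moreover have "\<forall>i\<le>2. irreducible_algebraic (Z i) \<and> Z i \<subseteq> D"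
    using sub D'(1) by (auto simp: Z_def irreducible_singleton irreducible_range_Q)
  ultimately have "enat 2 \<le> alg_dim D"
    unfolding alg_dim_def by (intro Sup_upper) blast
  then show False using D'(3) by (simp add: one_enat_def)
qed

section \<open>Generic injectivity and degree of the image\<close>

lemma finite_nonconjugate:
  assumes "\<xi> ^ n = 1" "\<xi> \<noteq> 1" shows "finite {t. poly p2 (\<xi> * t) = poly p2 t \<and> poly p3 (\<xi> * t) = poly p3 t}"
proof -
  have *: "finite {t. poly p (\<xi> * t) = poly p t}" if "pcompose p [:0, \<xi>:] \<noteq> p" for p
  proof -
    have "{t. poly p (\<xi> * t) = poly p t} = {t. poly (pcompose p [:0, \<xi>:] - p) t = 0}"
      by (auto simp: poly_pcompose mult.commute)
    then show ?thesis using poly_roots_finite[of "pcompose p [:0, \<xi>:] - p"] that by simp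
  qed
  have "pcompose p2 [:0, \<xi>:] \<noteq> p2 \<or> pcompose p3 [:0, \<xi>:] \<noteq> p3" using primitive assms by blast
  then show ?thesis
  proof
    assume "pcompose p2 [:0, \<xi>:] \<noteq> p2"
    then show ?thesis by (rule rev_finite_subset[OF *]) auto
  next
    assume "pcompose p3 [:0, \<xi>:] \<noteq> p3"
    then show ?thesis by (rule rev_finite_subset[OF *]) auto
  qed
qed

text \<open>Equal first coordinates force s = \<xi> * t with \<xi> ^ n = 1, and only finitely many
  \<xi> occur.\<close>

lemma finite_noninjective: "finite {t. \<exists>s. s \<noteq> t \<and> Q s = Q t}"
proof (rule finite_subset)
  show "{t. \<exists>s. s \<noteq> t \<and> Q s = Q t} \<subseteq>
      (\<Union>\<xi>\<in>{\<xi>. \<xi> ^ n = 1} - {1}. {t. poly p2 (\<xi> * t) = poly p2 t \<and> poly p3 (\<xi> * t) = poly p3 t})"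
  proof
    fix t assume "t \<in> {t. \<exists>s. s \<noteq> t \<and> Q s = Q t}"
    then obtain s where s: "s \<noteq> t" "Q s = Q t" by blast
    then obtain \<xi> where "\<xi> ^ n = 1" "s = \<xi> * t" using same_power_conj[of s t] by (auto simp: Q_def)
    then show "t \<in> (\<Union>\<xi>\<in>{\<xi>. \<xi> ^ n = 1} - {1}. {t. poly p2 (\<xi> * t) = poly p2 t \<and> poly p3 (\<xi> * t) = poly p3 t})"
      using s by (auto simp: Q_def)
  qed
  show "finite (\<Union>\<xi>\<in>{\<xi>. \<xi> ^ n = 1} - {1}. {t. poly p2 (\<xi> * t) = poly p2 t \<and> poly p3 (\<xi> * t) = poly p3 t})"
    using n by (intro finite_UN_I finite_Diff finite_roots_unity finite_nonconjugate) auto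
qed

text \<open>The pullback along \<open>Q\<close> of the equation of \<open>plane a b c e\<close>; its
  roots are the parameters of the plane section.\<close>

definition line_poly :: "complex \<Rightarrow> complex \<Rightarrow> complex \<Rightarrow> complex \<Rightarrow> complex poly" where
  "line_poly a b c e = smult a (monom 1 n) + smult b p2 + smult c p3 - [:e:]"

lemma poly_line_poly: "poly (line_poly a b c e) t = a * t ^ n + b * poly p2 t + c * poly p3 t - e"
  by (simp add: line_poly_def poly_monom)

lemma pderiv_line_poly: "pderiv (line_poly a b c e) = pderiv (line_poly a b c 0)"
  by (simp add: line_poly_def pderiv_diff pderiv_pCons)

lemma coeff_line_poly: "coeff (line_poly a b c e) n = a + b * coeff p2 n + c * coeff p3 n"
  using n by (simp add: line_poly_def coeff_pCons split: nat.splits)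

lemma degree_line_poly_le: "degree (line_poly a b c e) \<le> n"
  unfolding line_poly_def using degree_le
  by (intro degree_diff_le degree_add_le order_trans[OF degree_smult_le]) (auto simp: degree_monom_eq)

lemma degree_line_poly:
  assumes "a + b * coeff p2 n + c * coeff p3 n \<noteq> 0" shows "degree (line_poly a b c e) = n"
  using le_degree[of "line_poly a b c e" n] degree_line_poly_le[of a b c e] assms
  by (simp add: coeff_line_poly)

text \<open>For fixed a, b, c a multiple root occurs only if e is a critical value of
  \<open>line_poly a b c 0\<close>, and a nonconstant polynomial has finitely many of these.
  Elimination confines the exceptional planes to the zero set of one polynomial.\<close>

lemma generic_squarefree:
  "\<exists>F. F \<noteq> 0 \<and> (\<forall>a b c e. eval4 F a b c e \<noteq> 0 \<longrightarrow> rsquarefree (line_poly a b c e))"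
proof -
  define A B C E :: "complex poly4"
    where "A = [:[:[:[:0, 1:]:]:]:]" and "B = [:[:[:0, 1:]:]:]" and "C = [:[:0, 1:]:]" and "E = [:0, 1:]"
  have ev: "eval4 A a b c e = a" "eval4 B a b c e = b" "eval4 C a b c e = c" "eval4 E a b c e = e"
    "eval4 [:[:[:[:u:]:]:]:] a b c e = u" for a b c e u
    by (simp_all add: A_def B_def C_def E_def eval4_def)
  define lift :: "complex poly \<Rightarrow> complex poly4 poly" where "lift = map_poly (\<lambda>u. [:[:[:[:u:]:]:]:])"
  have coeff_lift: "coeff (lift p) i = [:[:[:[:coeff p i:]:]:]:]" for p i
    unfolding lift_def by (rule coeff_map_poly) simp
  \<comment> \<open>\<open>f\<close> and \<open>g\<close> are the universal \<open>line_poly\<close>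
    and its derivative in t, with the plane coefficients as indeterminates.\<close>
  define f where "f = smult A (lift (monom 1 n)) + smult B (lift p2) + smult C (lift p3) - [:E:]"
  define g where "g = smult A (lift (pderiv (monom 1 n))) + smult B (lift (pderiv p2)) + smult C (lift (pderiv p3))"
  interpret at4: hom_to_complex "\<lambda>F. eval4 F a b c e" for a b c e
    by unfold_locales auto
  have map_lift: "map_poly (\<lambda>F. eval4 F a b c e) (lift p) = p" for a b c e p
    by (rule poly_eqI) (simp add: coeff_map_poly coeff_lift ev)
  have map_f: "map_poly (\<lambda>F. eval4 F a b c e) f = line_poly a b c e" for a b c e
    by (simp add: f_def line_poly_def map_lift map_poly_pCons ev)
  have map_g: "map_poly (\<lambda>F. eval4 F a b c e) g = pderiv (line_poly a b c e)" for a b c e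
    by (simp add: g_def line_poly_def map_lift ev pderiv_diff pderiv_add pderiv_smult pderiv_pCons)
  have "\<exists>F. F \<noteq> 0 \<and> (\<forall>a b c e. eval4 F a b c e \<noteq> 0 \<longrightarrow>
      (\<forall>t. \<not> (poly (map_poly (\<lambda>F. eval4 F a b c e) f) t = 0 \<and> poly (map_poly (\<lambda>F. eval4 F a b c e) g) t = 0)))"
  proof (rule elimination_ideal)
    have "line_poly 0 0 0 1 \<noteq> 0" by (simp add: line_poly_def)
    then show "f \<noteq> 0" using map_f[of 0 0 0 1] by auto
  next
    fix G :: "complex poly4" assume "G \<noteq> 0"
    \<comment> \<open>\<open>L\<close> is the coefficient of t ^ n; where it is nonzero, the
      derivative is not the zero polynomial.\<close>
    define L where "L = A + B * [:[:[:[:coeff p2 n:]:]:]:] + C * [:[:[:[:coeff p3 n:]:]:]:]"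
    have ev_L: "eval4 L a b c e = a + b * coeff p2 n + c * coeff p3 n" for a b c e
      by (simp only: L_def eval4_simps ev)
    have "L \<noteq> 0" using ev_L[of 1 0 0 0] by auto
    with \<open>G \<noteq> 0\<close> have "G * L \<noteq> 0" by simp
    then obtain a b c e where abce: "eval4 (G * L) a b c e \<noteq> 0" using ex_eval4_nonzero by blast
    then have lc: "a + b * coeff p2 n + c * coeff p3 n \<noteq> 0" by (simp add: ev_L)
    have "(\<lambda>e. eval4 G a b c e) \<in> polyfuns {\<lambda>e. e}" by (intro polyfun polyfuns.gen) auto
    then have 1: "finite {e. eval4 G a b c e = 0}" by (rule polyfuns_finite_zeros) (use abce in auto)
    have "pderiv (line_poly a b c 0) \<noteq> 0"
      using degree_line_poly[OF lc, of 0] n by (auto simp: pderiv_eq_0_iff)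
    then have 2: "finite (poly (line_poly a b c 0) ` {t. poly (pderiv (line_poly a b c 0)) t = 0})"
      by (intro finite_imageI poly_roots_finite)
    obtain e' where "eval4 G a b c e' \<noteq> 0" "e' \<notin> poly (line_poly a b c 0) ` {t. poly (pderiv (line_poly a b c 0)) t = 0}"
      using ex_avoiding_finite[OF finite_UnI[OF 1 2]] by blast
    then have "eval4 G a b c e' \<noteq> 0 \<and> (\<forall>t. \<not> (poly (line_poly a b c e') t = 0 \<and> poly (pderiv (line_poly a b c e')) t = 0))"
      unfolding pderiv_line_poly[of a b c e'] by (auto simp: poly_line_poly image_iff)
    then show "\<exists>a b c e. eval4 G a b c e \<noteq> 0 \<and>
      (\<forall>t. \<not> (poly (map_poly (\<lambda>F. eval4 F a b c e) f) t = 0 \<and> poly (map_poly (\<lambda>F. eval4 F a b c e) g) t = 0))"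
      unfolding map_f map_g by blast
  qed
  then show ?thesis by (simp add: rsquarefree_roots map_f map_g)
qed

text \<open>\<open>F\<close> makes the roots of the plane equation simple, \<open>L\<close> makes
  its degree exactly n, and \<open>G\<close> keeps its roots away from the parameters at which
  \<open>Q\<close> is not injective.\<close>

lemma has_degree_range_Q: "has_degree (range Q) n"
proof -
  define T where "T = {t. \<exists>s. s \<noteq> t \<and> Q s = Q t}"
  have T: "finite T" unfolding T_def by (rule finite_noninjective)
  obtain F where F: "F \<noteq> 0" "\<And>a b c e. eval4 F a b c e \<noteq> 0 \<Longrightarrow> rsquarefree (line_poly a b c e)"
    using generic_squarefree by blast
  let ?X = "{\<lambda>(a, b, c, e). a, \<lambda>(a, b, c, e). b, \<lambda>(a, b, c, e). c, \<lambda>(a, b, c, e). e} :: (complex \<times> complex \<times> complex \<times> complex \<Rightarrow> complex) set"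
  have prod: "(\<lambda>v. \<Prod>t\<in>A. (case v of (a, b, c, e) \<Rightarrow> a) * t ^ n + (case v of (a, b, c, e) \<Rightarrow> b) * poly p2 t
      + (case v of (a, b, c, e) \<Rightarrow> c) * poly p3 t - (case v of (a, b, c, e) \<Rightarrow> e)) \<in> polyfuns ?X" if "finite A" for A
    using that
  proof induction
    case empty show ?case by (simp add: polyfuns.const)
  next
    case (insert t A)
    show ?case unfolding prod.insert[OF insert.hyps]
      by (intro polyfun insert.IH polyfuns.gen) auto
  qed
  obtain G where G: "\<And>a b c e. eval4 G a b c e = (\<Prod>t\<in>T. a * t ^ n + b * poly p2 t + c * poly p3 t - e)"
    using polyfuns_4[OF prod[OF T]] by auto
  have "(\<lambda>v. (case v of (a, b, c, e) \<Rightarrow> a) + (case v of (a, b, c, e) \<Rightarrow> b) * coeff p2 n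
      + (case v of (a, b, c, e) \<Rightarrow> c) * coeff p3 n) \<in> polyfuns ?X"
    by (intro polyfun polyfuns.gen) auto
  from polyfuns_4[OF this] obtain L where
    L: "\<And>a b c e. eval4 L a b c e = a + b * coeff p2 n + c * coeff p3 n" by (simp, metis)
  have "L \<noteq> 0" using L[of 1 0 0 0] by auto
  moreover have "G \<noteq> 0"
  proof -
    obtain e where "e \<notin> (\<lambda>t. t ^ n) ` T" using ex_avoiding_finite T by (meson finite_imageI)
    then have "eval4 G 1 0 0 e \<noteq> 0" unfolding G using T by auto
    then show ?thesis by auto
  qed
  ultimately have FGL: "F * G * L \<noteq> 0" using F(1) by simp
  show ?thesis unfolding has_degree_def
  proof (intro exI[of _ "F * G * L"] conjI FGL allI impI)
    fix a b c e assume *: "(a, b, c) \<noteq> (0, 0, 0) \<and> eval4 (F * G * L) a b c e \<noteq> 0"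
    define p where "p = line_poly a b c e"
    have lc: "a + b * coeff p2 n + c * coeff p3 n \<noteq> 0" using * by (auto simp: L)
    have deg: "degree p = n" unfolding p_def by (rule degree_line_poly[OF lc])
    then have p0: "p \<noteq> 0" using n by auto
    have "rsquarefree p" unfolding p_def using F(2) * by simp
    from complex_poly_decompose_rsquarefree[OF this] have "n = degree (\<Prod>z | poly p z = 0. [:- z, 1:])"
      using deg p0 by (metis degree_smult_eq leading_coeff_0_iff)
    also have "\<dots> = card {z. poly p z = 0}"
      by (subst degree_prod_sum_eq) auto
    finally have card: "card {z. poly p z = 0} = n" ..
    have eq: "range Q \<inter> plane a b c e = Q ` {z. poly p z = 0}"
      by (auto simp: plane_def Q_def p_def poly_line_poly)
    have "z \<notin> T" if "poly p z = 0" for z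
      using * that T by (auto simp: G p_def poly_line_poly)
    then have "inj_on Q {z. poly p z = 0}" by (auto simp: inj_on_def T_def)
    then show "finite (range Q \<inter> plane a b c e)" "card (range Q \<inter> plane a b c e) = n"
      unfolding eq using card by (auto simp: card_image intro!: finite_imageI poly_roots_finite p0)
  qed
qed

end

section \<open>Curves approached by a parametrized curve\<close>

text \<open>After the shear the plane reads x = s - \<eta> * w, so distinct \<open>w\<close> come
  from distinct points of the section. The factor \<open>a\<close> is kept so that given generic
  coefficients are themselves of this form.\<close>

lemma card_plane_section_ge:
  assumes fin: "finite (D \<inter> plane a (a * \<eta>) (a * \<eta> * k) (a * s))"
    and W: "\<And>w. w \<in> W \<Longrightarrow> \<exists>z. (s - \<eta> * w, w, z) \<in> shear k ` D"
  shows "finite W \<and> card W \<le> card (D \<inter> plane a (a * \<eta>) (a * \<eta> * k) (a * s))"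
proof -
  let ?S = "D \<inter> plane a (a * \<eta>) (a * \<eta> * k) (a * s)"
  have "W \<subseteq> (fst \<circ> snd \<circ> shear k) ` ?S"
  proof
    fix w assume "w \<in> W"
    then obtain z x y z' where p: "(x, y, z') \<in> D" "(s - \<eta> * w, w, z) = shear k (x, y, z')" using W by force
    then have xy: "x = s - \<eta> * w" "y = w - k * z'" by (auto simp: shear_def)
    then have "a * x + a * \<eta> * y + a * \<eta> * k * z' = a * s" unfolding xy by (simp add: algebra_simps)
    then have "(x, y, z') \<in> ?S" using p(1) by (simp add: plane_def)
    then show "w \<in> (fst \<circ> snd \<circ> shear k) ` ?S"
      using p(2) by (intro image_eqI[of _ _ "(x, y, z')"]) (auto simp: shear_def)
  qed
  then show ?thesis using fin by (meson card_image_le card_mono finite_imageI finite_subset order_trans)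
qed

lemma eventually_notin_finite_at_infinity:
  assumes "finite X" shows "\<forall>\<^sub>F s::complex in at_infinity. s \<notin> X"
proof -
  obtain b where "\<And>x. x \<in> X \<Longrightarrow> norm x \<le> b"
    using finite_imp_bounded[OF assms] by (auto simp: bounded_iff)
  then show ?thesis by (intro eventually_at_infinityI[of "b + 1"]) fastforce
qed

lemma eventually_notin_finite_at:
  assumes "finite X" shows "\<forall>\<^sub>F s::complex in at a. s \<notin> X"
proof -
  have "open (- (X - {a}))" using assms by (intro open_Compl finite_imp_closed) auto
  then have "\<forall>\<^sub>F s in at a. s \<in> - (X - {a}) \<and> s \<noteq> a"
    by (intro eventually_conj eventually_at_in_open') (auto intro: eventually_neq_at_within)
  then show ?thesis by eventually_elim auto
qed

lemma space_curve_projection: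
  assumes C: "space_curve D"
    and F: "\<And>a b c e'. (a, b, c) \<noteq> (0, 0, 0) \<Longrightarrow> eval4 F a b c e' \<noteq> 0 \<Longrightarrow> finite (D \<inter> plane a b c e')"
    and k: "a \<noteq> 0" "eval4 F a (a * \<eta>0) (a * \<eta>0 * k) (a * s0) \<noteq> 0"
  shows "\<exists>P S. P \<noteq> 0 \<and> finite S \<and> (\<forall>x w z. (x, w, z) \<in> shear k ` D \<longrightarrow> eval2 P x w = 0) \<and>
    (\<forall>s w. s \<notin> S \<and> eval2 P s w = 0 \<longrightarrow> (\<exists>z. (s, w, z) \<in> shear k ` D))"
proof -
  obtain \<C> where \<C>: "finite \<C>" "\<And>V. V \<in> \<C> \<Longrightarrow> irreducible_algebraic V" "D = \<Union>\<C>"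
    using C by (auto simp: space_curve_def irreducible_curve_def)
  have "\<exists>P S. P \<noteq> 0 \<and> finite S \<and> (\<forall>x w z. (x, w, z) \<in> shear k ` V \<longrightarrow> eval2 P x w = 0) \<and>
      (\<forall>s w. s \<notin> S \<and> eval2 P s w = 0 \<longrightarrow> (\<exists>z. (s, w, z) \<in> shear k ` V))" if V: "V \<in> \<C>" for V
  proof (rule disjE[OF irreducible_projection[OF irreducible_shear[OF \<C>(2)[OF V]], of k]])
    assume "\<exists>r. r \<noteq> 0 \<and> (\<forall>s w. eval2 r s w \<noteq> 0 \<longrightarrow> (\<exists>z. (s, w, z) \<in> shear k ` V))"
    \<comment> \<open>If a component dominated the plane, a line x = s - \<eta> * w not inside the
      zero set of \<open>r\<close> would lift to infinitely many points of a finite plane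
      section.\<close>
    then obtain r where r: "r \<noteq> 0" "\<And>s w. eval2 r s w \<noteq> 0 \<Longrightarrow> \<exists>z. (s, w, z) \<in> shear k ` V" by blast
    obtain s1 w1 where sw: "eval2 r s1 w1 \<noteq> 0" using ex_eval2_nonzero[OF r(1)] by blast
    have 1: "finite {s. eval4 F a (a * \<eta>0) (a * \<eta>0 * k) (a * s) = 0}"
      by (rule polyfuns_finite_zeros[where ?x0.0 = s0]) (intro polyfun polyfuns.gen, simp_all add: k)
    have 2: "finite {s. eval2 r s w1 = 0}"
      by (rule polyfuns_finite_zeros[where ?x0.0 = s1]) (intro polyfun polyfuns.gen, simp_all add: sw)
    obtain s where s: "eval4 F a (a * \<eta>0) (a * \<eta>0 * k) (a * s) \<noteq> 0" "eval2 r s w1 \<noteq> 0"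
      using ex_avoiding_finite[OF finite_UnI[OF 1 2]] by blast
    \<comment> \<open>With s fixed, F is nonzero at \<eta>0 and \<open>r\<close> is nonzero at
      \<eta> = 0, so each condition excludes finitely many \<eta>.\<close>
    have 3: "finite {\<eta>. eval4 F a (a * \<eta>) (a * \<eta> * k) (a * s) = 0}"
      by (rule polyfuns_finite_zeros[where ?x0.0 = \<eta>0]) (intro polyfun polyfuns.gen, simp_all add: s)
    have 4: "finite {\<eta>. eval2 r (s - \<eta> * w1) w1 = 0}"
      by (rule polyfuns_finite_zeros[where ?x0.0 = 0]) (intro polyfun polyfuns.gen, simp_all add: s)
    obtain \<eta> where \<eta>: "eval4 F a (a * \<eta>) (a * \<eta> * k) (a * s) \<noteq> 0" "eval2 r (s - \<eta> * w1) w1 \<noteq> 0"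
      using ex_avoiding_finite[OF finite_UnI[OF 3 4]] by blast
    have 5: "finite {w. eval2 r (s - \<eta> * w) w = 0}"
      by (rule polyfuns_finite_zeros[where ?x0.0 = w1]) (intro polyfun polyfuns.gen, simp_all add: \<eta>)
    have "finite (D \<inter> plane a (a * \<eta>) (a * \<eta> * k) (a * s))" using F \<eta>(1) k(1) by simp
    then have "finite {w. eval2 r (s - \<eta> * w) w \<noteq> 0}"
    proof (rule conjunct1[OF card_plane_section_ge])
      fix w assume "w \<in> {w. eval2 r (s - \<eta> * w) w \<noteq> 0}"
      then have "\<exists>z. (s - \<eta> * w, w, z) \<in> shear k ` V" using r(2) by blast
      then show "\<exists>z. (s - \<eta> * w, w, z) \<in> shear k ` D" using V unfolding \<C>(3) by blast
    qed
    with 5 have "finite ({w. eval2 r (s - \<eta> * w) w = 0} \<union> {w. eval2 r (s - \<eta> * w) w \<noteq> 0})" by (rule finite_UnI)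
    then have "finite (UNIV :: complex set)" by (rule rev_finite_subset) auto
    then show ?thesis using infinite_UNIV_char_0 by blast
  qed
  then obtain P S where PS: "\<And>V. V \<in> \<C> \<Longrightarrow> P V \<noteq> 0" "\<And>V. V \<in> \<C> \<Longrightarrow> finite (S V)"
    "\<And>V x w z. V \<in> \<C> \<Longrightarrow> (x, w, z) \<in> shear k ` V \<Longrightarrow> eval2 (P V) x w = 0"
    "\<And>V s w. V \<in> \<C> \<Longrightarrow> s \<notin> S V \<Longrightarrow> eval2 (P V) s w = 0 \<Longrightarrow> \<exists>z. (s, w, z) \<in> shear k ` V"
    by metis
  have prod: "eval2 (\<Prod>V\<in>\<C>. P V) x w = 0 \<longleftrightarrow> (\<exists>V\<in>\<C>. eval2 (P V) x w = 0)" for x w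
    using \<C>(1) by induction auto
  have "(\<Prod>V\<in>\<C>. P V) \<noteq> 0" using \<C>(1) PS(1) by simp
  moreover have "finite (\<Union>V\<in>\<C>. S V)" using \<C>(1) PS(2) by blast
  moreover have "eval2 (\<Prod>V\<in>\<C>. P V) x w = 0" if "(x, w, z) \<in> shear k ` D" for x w z
    using that PS(3) unfolding prod \<C>(3) by blast
  moreover have "\<exists>z. (s, w, z) \<in> shear k ` D" if sw: "s \<notin> (\<Union>V\<in>\<C>. S V)" "eval2 (\<Prod>V\<in>\<C>. P V) s w = 0" for s w
  proof -
    obtain V where "V \<in> \<C>" "eval2 (P V) s w = 0" using sw(2) prod by blast
    then show ?thesis using PS(4)[of V s w] sw(1) unfolding \<C>(3) by blast
  qed
  ultimately show ?thesis
    by (intro exI[of _ "\<Prod>V\<in>\<C>. P V"] exI[of _ "\<Union>V\<in>\<C>. S V"]) simp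
qed

lemma ex_close_point:
  fixes A :: "'a::metric_space set"
  assumes "A \<noteq> {}" "\<epsilon> > 0" shows "\<exists>d\<in>A. dist x d < infdist x A + \<epsilon>"
proof (rule ccontr)
  assume "\<not> ?thesis"
  then have "infdist x A + \<epsilon> \<le> infdist x A"
    using assms(1) unfolding infdist_notempty[OF assms(1)] by (intro cINF_greatest) (auto simp: not_less)
  then show False using assms(2) by simp
qed

section \<open>Lower bound for the degree of an approaching curve\<close>

context param_curve
begin

text \<open>Some coefficient of the difference between the combination and its conjugate is a
  nonzero polynomial of degree at most 1 in k.\<close>

lemma finite_imprimitive_combination:
  assumes "\<xi> ^ n = 1" "\<xi> \<noteq> 1"
  shows "finite {k. pcompose (p2 + smult k p3) [:0, \<xi>:] = p2 + smult k p3}"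
proof -
  define u2 u3 where "u2 = pcompose p2 [:0, \<xi>:] - p2" and "u3 = pcompose p3 [:0, \<xi>:] - p3"
  have "u2 \<noteq> 0 \<or> u3 \<noteq> 0" using primitive assms by (auto simp: u2_def u3_def)
  then obtain i where "coeff u2 i \<noteq> 0 \<or> coeff u3 i \<noteq> 0" by (auto simp: poly_eq_iff)
  then have "[:coeff u2 i, coeff u3 i:] \<noteq> 0" by auto
  then have "finite {k. poly [:coeff u2 i, coeff u3 i:] k = 0}" by (rule poly_roots_finite)
  moreover have "poly [:coeff u2 i, coeff u3 i:] k = 0"
    if "pcompose (p2 + smult k p3) [:0, \<xi>:] = p2 + smult k p3" for k
  proof -
    have "u2 + smult k u3 = 0"
      using that by (simp add: u2_def u3_def pcompose_add pcompose_smult smult_diff_right algebra_simps)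
    from arg_cong[OF this, of "\<lambda>p. coeff p i"] show ?thesis by simp
  qed
  then have "{k. pcompose (p2 + smult k p3) [:0, \<xi>:] = p2 + smult k p3} \<subseteq>
      {k. poly [:coeff u2 i, coeff u3 i:] k = 0}"
    by blast
  ultimately show ?thesis by (meson finite_subset)
qed

lemma degree_approaching_ge:
  assumes C: "space_curve D" and deg: "has_degree D e"
    and t: "filterlim t at_infinity sequentially" and d: "(\<lambda>j. infdist (Q (t j)) D) \<longlonglongrightarrow> 0"
  shows "n \<le> e"
proof -
  obtain F where F: "F \<noteq> 0" "\<And>a b c e'. (a, b, c) \<noteq> (0, 0, 0) \<Longrightarrow> eval4 F a b c e' \<noteq> 0 \<Longrightarrow>
      finite (D \<inter> plane a b c e') \<and> card (D \<inter> plane a b c e') = e"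
    using deg by (auto simp: has_degree_def)
  obtain a b c e0 where abc: "a \<noteq> 0" "b \<noteq> 0" "eval4 F a b c e0 \<noteq> 0"
    using ex_eval4_nonzero[OF F(1)] by blast
  \<comment> \<open>For k = c / b these recover the generic plane: a * \<eta>0 = b, a * \<eta>0 * k
    = c, a * s0 = e0. Hence F does not vanish identically in k.\<close>
  define \<eta>0 s0 where "\<eta>0 = b / a" and "s0 = e0 / a"
  have 1: "finite {k. eval4 F a (a * \<eta>0) (a * \<eta>0 * k) (a * s0) = 0}"
    by (rule polyfuns_finite_zeros[where ?x0.0 = "c / b"])
      (intro polyfun polyfuns.gen, simp_all add: \<eta>0_def s0_def abc)
  have 2: "finite (\<Union>\<xi>\<in>{\<xi>. \<xi> ^ n = 1} - {1}. {k. pcompose (p2 + smult k p3) [:0, \<xi>:] = p2 + smult k p3})"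
    using n by (intro finite_UN_I finite_Diff finite_roots_unity finite_imprimitive_combination) auto
  obtain k where k: "eval4 F a (a * \<eta>0) (a * \<eta>0 * k) (a * s0) \<noteq> 0"
      "\<And>\<xi>. \<xi> ^ n = 1 \<Longrightarrow> \<xi> \<noteq> 1 \<Longrightarrow> pcompose (p2 + smult k p3) [:0, \<xi>:] \<noteq> p2 + smult k p3"
    using ex_avoiding_finite[OF finite_UnI[OF 1 2]] by blast
  obtain P S where P: "P \<noteq> 0" "finite S" "\<And>x w z. (x, w, z) \<in> shear k ` D \<Longrightarrow> eval2 P x w = 0"
    and lift: "\<And>s w. s \<notin> S \<Longrightarrow> eval2 P s w = 0 \<Longrightarrow> \<exists>z. (s, w, z) \<in> shear k ` D"
    using space_curve_projection[OF C _ abc(1) k(1)] F(2) by metis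
  have "D \<noteq> {}" using C by (auto simp: space_curve_def irreducible_curve_def irreducible_algebraic_def)
  then have "\<exists>p\<in>D. dist (Q (t j)) p < infdist (Q (t j)) D + 1 / real (Suc j)" for j
    by (intro ex_close_point) auto
  then obtain p where p: "\<And>j. p j \<in> D" "\<And>j. dist (Q (t j)) (p j) < infdist (Q (t j)) D + 1 / real (Suc j)"
    by metis
  have "(\<lambda>j. infdist (Q (t j)) D + 1 / real (Suc j)) \<longlonglongrightarrow> 0 + 0"
    using LIMSEQ_inverse_real_of_nat by (intro tendsto_add d) (simp add: inverse_eq_divide)
  then have "(\<lambda>j. dist (p j) (Q (t j))) \<longlonglongrightarrow> 0"
    using p(2) by (intro tendsto_sandwich[of "\<lambda>_. 0" "\<lambda>j. dist (p j) (Q (t j))" sequentially]) (auto simp: dist_commute less_imp_le)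
  then have lim: "(\<lambda>j. p j - Q (t j)) \<longlonglongrightarrow> 0"
    by (simp add: dist_norm tendsto_norm_zero_iff)
  have lims: "(\<lambda>j. fst (p j) - t j ^ n) \<longlonglongrightarrow> 0" "(\<lambda>j. fst (snd (p j)) - poly p2 (t j)) \<longlonglongrightarrow> 0"
    "(\<lambda>j. snd (snd (p j)) - poly p3 (t j)) \<longlonglongrightarrow> 0"
    using tendsto_fst[OF lim] tendsto_fst[OF tendsto_snd[OF lim]] tendsto_snd[OF tendsto_snd[OF lim]]
    by (simp_all add: Q_def)
  have "\<forall>\<^sub>F t in at_infinity. \<exists>W. card W = n \<and> (\<forall>w\<in>W. eval2 P (t ^ n) w = 0)"
  proof (rule conjugate_roots[OF P(1) n _ k(2) t lims(1)])
    show "degree (p2 + smult k p3) \<le> n"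
      using degree_le by (intro degree_add_le order_trans[OF degree_smult_le])
    show "(\<lambda>j. fst (snd (p j)) + k * snd (snd (p j)) - poly (p2 + smult k p3) (t j)) \<longlonglongrightarrow> 0"
      using tendsto_add[OF lims(2) tendsto_mult[OF tendsto_const[of k] lims(3)]] by (simp add: algebra_simps)
    show "eval2 P (fst (p j)) (fst (snd (p j)) + k * snd (snd (p j))) = 0" for j
      by (rule P(3)[of _ _ "snd (snd (p j))"]) (use p(1)[of j] in \<open>auto simp: shear_def split_beta intro!: image_eqI[of _ _ "p j"]\<close>)
  qed
  moreover
  obtain s1 w1 where sw: "eval2 P s1 w1 \<noteq> 0" using ex_eval2_nonzero[OF P(1)] by blast
  have 1: "finite {s. eval4 F a (a * \<eta>0) (a * \<eta>0 * k) (a * s) = 0}"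
    by (rule polyfuns_finite_zeros[where ?x0.0 = s0]) (intro polyfun polyfuns.gen, simp_all add: k)
  have 2: "finite {s. eval2 P s w1 = 0}"
    by (rule polyfuns_finite_zeros[where ?x0.0 = s1]) (intro polyfun polyfuns.gen, simp_all add: sw)
  \<comment> \<open>The abscissa s = t ^ n must leave F nonzero at \<eta>0, P not identically zero
    over s, and the roots over s liftable to \<open>D\<close>.\<close>
  have "\<forall>\<^sub>F t in at_infinity. t ^ n \<notin> {s. eval4 F a (a * \<eta>0) (a * \<eta>0 * k) (a * s) = 0} \<union> {s. eval2 P s w1 = 0} \<union> S"
    using filterlim_power_at_infinity[of n] n
    by (intro eventually_compose_filterlim[OF eventually_notin_finite_at_infinity] finite_UnI 1 2 P) auto
  ultimately have "\<forall>\<^sub>F t in at_infinity. (\<exists>W. card W = n \<and> (\<forall>w\<in>W. eval2 P (t ^ n) w = 0)) \<and>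
      t ^ n \<notin> {s. eval4 F a (a * \<eta>0) (a * \<eta>0 * k) (a * s) = 0} \<union> {s. eval2 P s w1 = 0} \<union> S"
    by (rule eventually_conj)
  then obtain s W where s: "card W = n" "\<And>w. w \<in> W \<Longrightarrow> eval2 P s w = 0"
      "eval4 F a (a * \<eta>0) (a * \<eta>0 * k) (a * s) \<noteq> 0" "eval2 P s w1 \<noteq> 0" "s \<notin> S"
    using eventually_happens'[OF trivial_limit_at_infinity] by blast
  have "finite W" using s(1) n by (metis card_ge_0_finite)
  \<comment> \<open>F may vanish at the plane x = s itself, so the n roots are carried over to
    tilted planes, almost all of which are generic.\<close>
  then have "\<forall>\<^sub>F \<eta> in at 0. \<exists>W'. card W' = card W \<and> (\<forall>w\<in>W'. s - \<eta> * w \<notin> S \<and> eval2 P (s - \<eta> * w) w = 0)"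
    by (rule perturbed_roots[OF P(2) s(5) _ s(2,4)])
  moreover have "finite {\<eta>. eval4 F a (a * \<eta>) (a * \<eta> * k) (a * s) = 0}"
    by (rule polyfuns_finite_zeros[where ?x0.0 = \<eta>0]) (intro polyfun polyfuns.gen, simp_all add: s)
  then have "\<forall>\<^sub>F \<eta> in at 0. \<eta> \<notin> {\<eta>. eval4 F a (a * \<eta>) (a * \<eta> * k) (a * s) = 0}"
    by (rule eventually_notin_finite_at)
  ultimately have "\<forall>\<^sub>F \<eta> in at 0. (\<exists>W'. card W' = card W \<and> (\<forall>w\<in>W'. s - \<eta> * w \<notin> S \<and> eval2 P (s - \<eta> * w) w = 0)) \<and>
      \<eta> \<notin> {\<eta>. eval4 F a (a * \<eta>) (a * \<eta> * k) (a * s) = 0}"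
    by (rule eventually_conj)
  then obtain \<eta> W' where \<eta>: "card W' = n" "\<And>w. w \<in> W' \<Longrightarrow> s - \<eta> * w \<notin> S"
      "\<And>w. w \<in> W' \<Longrightarrow> eval2 P (s - \<eta> * w) w = 0" "eval4 F a (a * \<eta>) (a * \<eta> * k) (a * s) \<noteq> 0"
    using eventually_happens'[OF at_neq_bot] s(1) by blast
  have "finite (D \<inter> plane a (a * \<eta>) (a * \<eta> * k) (a * s)) \<and> card (D \<inter> plane a (a * \<eta>) (a * \<eta> * k) (a * s)) = e"
    using F(2) \<eta>(4) abc(1) by simp
  moreover from this
  have "card W' \<le> card (D \<inter> plane a (a * \<eta>) (a * \<eta> * k) (a * s))"
    by (intro conjunct2[OF card_plane_section_ge]) (auto intro!: lift \<eta>)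
  ultimately show ?thesis using \<eta>(1) by simp
qed

end

section \<open>Truncation of infinity branches\<close>

lemma trunc_denom_dvd: "trunc_denom \<phi> dvd ramif \<phi>"
  unfolding trunc_denom_def by (metis Gcd_dvd dvd_div_mult_self dvd_triv_left insertI1)

text \<open>Makes the natural-number division in \<open>trunc_poly\<close> exact for every term that
  is present.\<close>

lemma trunc_exponent_exact:
  assumes n: "trunc_denom \<phi> dvd n" and i: "i \<le> ramif \<phi>" "fps_nth (ser \<phi>) i \<noteq> 0"
  shows "ramif \<phi> dvd n * (ramif \<phi> - i)"
proof -
  define g where "g = Gcd (insert (ramif \<phi>) {i. i \<le> ramif \<phi> \<and> fps_nth (ser \<phi>) i \<noteq> 0})"
  have "g dvd ramif \<phi>" "g dvd i" unfolding g_def by (rule Gcd_dvd, use i in simp)+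
  then have "g dvd ramif \<phi> - i" "ramif \<phi> = trunc_denom \<phi> * g"
    by (auto simp: trunc_denom_def g_def dvd_diff_nat)
  then show ?thesis using mult_dvd_mono[OF n] by metis
qed

lemma degree_trunc_poly_le: "degree (trunc_poly n \<phi>) \<le> n"
  unfolding trunc_poly_def
proof (intro degree_sum_le order_trans[OF degree_monom_le])
  fix i show "n * (ramif \<phi> - i) div ramif \<phi> \<le> n"
    using div_le_mono[of "n * (ramif \<phi> - i)" "n * ramif \<phi>" "ramif \<phi>"] by (cases "ramif \<phi> = 0") auto
qed auto

lemma poly_trunc_poly:
  "poly (trunc_poly n \<phi>) t = (\<Sum>i\<le>ramif \<phi>. fps_nth (ser \<phi>) i * t ^ (n * (ramif \<phi> - i) div ramif \<phi>))"
  by (simp add: trunc_poly_def poly_sum poly_monom)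

text \<open>By exactness, different indices with nonzero coefficients have different exponents, so
  no two terms merge.\<close>

lemma coeff_trunc_poly:
  assumes \<phi>: "ramif \<phi> > 0" and n: "n > 0" "trunc_denom \<phi> dvd n" and i: "i \<le> ramif \<phi>" "fps_nth (ser \<phi>) i \<noteq> 0"
  shows "coeff (trunc_poly n \<phi>) (n * (ramif \<phi> - i) div ramif \<phi>) = fps_nth (ser \<phi>) i"
proof -
  have "(if n * (ramif \<phi> - j) div ramif \<phi> = n * (ramif \<phi> - i) div ramif \<phi> then fps_nth (ser \<phi>) j else 0) =
      (if j = i then fps_nth (ser \<phi>) i else 0)" if "j \<le> ramif \<phi>" for j
  proof (cases "fps_nth (ser \<phi>) j = 0")
    case False
    have "n * (ramif \<phi> - j) = n * (ramif \<phi> - i)"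
      if "n * (ramif \<phi> - j) div ramif \<phi> = n * (ramif \<phi> - i) div ramif \<phi>"
      using trunc_exponent_exact[OF n(2) i] trunc_exponent_exact[OF n(2) \<open>j \<le> ramif \<phi>\<close> False] that
      by (metis dvd_div_mult_self)
    then show ?thesis using n(1) that i(1) by auto
  qed (use i in auto)
  then show ?thesis using i by (simp add: trunc_poly_def coeff_sum)
qed

lemma ex_multiplicative_order:
  fixes \<xi> :: complex
  assumes "n > 0" "\<xi> ^ n = 1" shows "\<exists>d. \<forall>m. \<xi> ^ m = 1 \<longleftrightarrow> d dvd m"
proof -
  define d where "d = (LEAST m. m > 0 \<and> \<xi> ^ m = 1)"
  have d: "d > 0" "\<xi> ^ d = 1" using LeastI[of "\<lambda>m. m > 0 \<and> \<xi> ^ m = 1" n] assms by (auto simp: d_def)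
  have "d dvd m" if "\<xi> ^ m = 1" for m
  proof (rule ccontr)
    assume "\<not> d dvd m"
    then have r: "0 < m mod d" "m mod d < d" using d by (auto simp: dvd_eq_mod_eq_0)
    have "\<xi> ^ m = (\<xi> ^ d) ^ (m div d) * \<xi> ^ (m mod d)" by (simp flip: power_mult power_add)
    then have "\<xi> ^ (m mod d) = 1" using that d by simp
    then have "d \<le> m mod d" unfolding d_def using r by (intro Least_le) (auto simp: d_def)
    then show False using r by simp
  qed
  then show ?thesis using d by (metis dvdE power_mult power_one)
qed

text \<open>Write \<open>ramif \<phi>\<close> = \<open>trunc_denom \<phi>\<close> * g and n =
  \<open>trunc_denom \<phi>\<close> * m. The term of index g * i' has exponent m *
  (\<open>trunc_denom \<phi>\<close> - i'), which d divides by invariance. As d divides n, it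
  divides every m * i', hence m, the i' having gcd 1.\<close>

lemma conjugate_trunc_poly:
  assumes \<phi>: "ramif \<phi> > 0" and n: "n > 0" "trunc_denom \<phi> dvd n"
    and d: "d dvd n" "\<And>m. \<xi> ^ m = 1 \<longleftrightarrow> d dvd m"
    and eq: "pcompose (trunc_poly n \<phi>) [:0, \<xi>:] = trunc_poly n \<phi>"
  shows "d * trunc_denom \<phi> dvd n"
proof -
  define A where "A = insert (ramif \<phi>) {i. i \<le> ramif \<phi> \<and> fps_nth (ser \<phi>) i \<noteq> 0}"
  define g where "g = Gcd A"
  have g_dvd: "g dvd i" if "i \<in> A" for i using that by (simp add: g_def)
  have N: "ramif \<phi> = trunc_denom \<phi> * g" using g_dvd[of "ramif \<phi>"] by (simp add: trunc_denom_def g_def A_def)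
  then have g: "g > 0" "trunc_denom \<phi> > 0" using \<phi> by (auto intro: Nat.gr0I)
  obtain m where m: "n = trunc_denom \<phi> * m" using n(2) by blast
  have "d * g dvd m * i" if i: "i \<in> A" for i
  proof -
    obtain i' where i': "i = g * i'" using g_dvd[OF i] by blast
    have "d dvd m * i'"
    proof (cases "fps_nth (ser \<phi>) i = 0")
      \<comment> \<open>\<open>ramif \<phi>\<close> is in \<open>A\<close> even if its coefficient
        is 0; this index is settled by d dividing n.\<close>
      case True
      then have "i = ramif \<phi>" using i by (auto simp: A_def)
      then have "i' = trunc_denom \<phi>" using i' N g by simp
      then show ?thesis using d(1) m by (simp add: mult.commute)
    next
      case False
      have i_le: "i \<le> ramif \<phi>" using i by (auto simp: A_def)
      have "n * (ramif \<phi> - i) = ramif \<phi> * (m * (trunc_denom \<phi> - i'))"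
        by (simp add: m N i' algebra_simps diff_mult_distrib2)
      then have E: "n * (ramif \<phi> - i) div ramif \<phi> = m * (trunc_denom \<phi> - i')" using \<phi> by simp
      have "\<xi> ^ (n * (ramif \<phi> - i) div ramif \<phi>) * fps_nth (ser \<phi>) i = fps_nth (ser \<phi>) i"
        using arg_cong[OF eq, of "\<lambda>p. coeff p (n * (ramif \<phi> - i) div ramif \<phi>)"]
        unfolding coeff_pcompose_linear coeff_trunc_poly[OF \<phi> n i_le False] .
      then have "d dvd m * (trunc_denom \<phi> - i')" using False by (simp add: E flip: d(2))
      moreover have "i' \<le> trunc_denom \<phi>" using i_le N i' g by simp
      then have "m * i' = n - m * (trunc_denom \<phi> - i')"
        by (simp add: m algebra_simps diff_mult_distrib2)
      ultimately show ?thesis using d(1) by (simp add: dvd_diff_nat)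
    qed
    then have "g * d dvd g * (m * i')" by (intro mult_dvd_mono) auto
    then show ?thesis by (simp add: i' mult_ac)
  qed
  then have "d * g dvd Gcd ((*) m ` A)" by (intro Gcd_greatest) auto
  then have "d * g dvd m * g" by (simp add: Gcd_mult g_def)
  then have "d dvd m" using g by simp
  then show ?thesis using m by (simp add: mult.commute)
qed

text \<open>The part of \<open>reduced\<close> that truncation preserves; a truncated branch need
  not be reduced.\<close>

definition branch_ok :: "branch \<Rightarrow> bool" where
  "branch_ok B \<longleftrightarrow> ramif (ser2 B) > 0 \<and> ramif (ser3 B) > 0"

lemma branch_degree_pos: "branch_ok B \<Longrightarrow> branch_degree B > 0"
  using trunc_denom_dvd[of "ser2 B"] trunc_denom_dvd[of "ser3 B"]
  by (auto simp: branch_ok_def branch_degree_def intro!: lcm_pos_nat intro: dvd_pos_nat)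

lemma branch_ramif_pos: "branch_ok B \<Longrightarrow> branch_ramif B > 0"
  by (auto simp: branch_ok_def branch_ramif_def lcm_pos_nat)

text \<open>A symmetry \<xi> of order d makes both denominators divide n / d; as n is their least
  common multiple, d = 1.\<close>

lemma param_curve_trunc:
  assumes B: "branch_ok B"
  shows "param_curve (branch_degree B) (trunc_poly (branch_degree B) (ser2 B)) (trunc_poly (branch_degree B) (ser3 B))"
proof
  show n: "branch_degree B > 0" by (rule branch_degree_pos[OF B])
  show "degree (trunc_poly (branch_degree B) (ser2 B)) \<le> branch_degree B"
    "degree (trunc_poly (branch_degree B) (ser3 B)) \<le> branch_degree B" by (rule degree_trunc_poly_le)+
  fix \<xi> :: complex
  assume \<xi>: "\<xi> ^ branch_degree B = 1"
    "pcompose (trunc_poly (branch_degree B) (ser2 B)) [:0, \<xi>:] = trunc_poly (branch_degree B) (ser2 B)"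
    "pcompose (trunc_poly (branch_degree B) (ser3 B)) [:0, \<xi>:] = trunc_poly (branch_degree B) (ser3 B)"
  obtain d where d: "\<And>m. \<xi> ^ m = 1 \<longleftrightarrow> d dvd m" using ex_multiplicative_order[OF n \<xi>(1)] by blast
  then obtain n' where n': "branch_degree B = d * n'" using \<xi>(1) by (metis dvdE)
  have pos: "d > 0" "n' > 0" using n n' by auto
  have td: "trunc_denom (ser2 B) dvd branch_degree B" "trunc_denom (ser3 B) dvd branch_degree B"
    by (simp_all add: branch_degree_def)
  have d_dvd: "d dvd branch_degree B" using n' by simp
  have "d * trunc_denom (ser2 B) dvd branch_degree B" "d * trunc_denom (ser3 B) dvd branch_degree B"
    using B by (auto intro!: conjugate_trunc_poly[OF _ n _ _ d] \<xi>(2,3) simp: branch_ok_def td d_dvd)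
  then have "trunc_denom (ser2 B) dvd n'" "trunc_denom (ser3 B) dvd n'"
    using pos by (simp_all add: n')
  then have "branch_degree B dvd n'" by (simp add: branch_degree_def)
  then have "d * n' \<le> 1 * n'" using n' pos dvd_imp_le by simp
  then have "d = 1" using pos unfolding mult_le_cancel2 by simp
  then show "\<xi> = 1" using d[of 1] by simp
qed

section \<open>Leaves in a uniformizing coordinate\<close>

lemma powr_root_power:
  fixes z :: complex
  assumes "z \<noteq> 0" shows "(z powr (- 1 / of_nat N)) ^ k = z powr (- (of_nat k / of_nat N))"
  using assms by (simp add: powr_def flip: exp_of_nat_mult)

text \<open>One N-th root \<open>u\<close> of 1 / z serves both series and all leaves; choosing
  \<open>c\<close> amounts to choosing this root.\<close>

lemma leaf_point_altdef:
  assumes B: "branch_ok B" and z: "z \<noteq> 0" and c: "c ^ branch_ramif B = 1"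
  defines "u \<equiv> c * z powr (- 1 / of_nat (branch_ramif B))"
  shows "u ^ branch_ramif B = inverse z"
    and "leaf_point B c z = (z, z * eval_fps (ser (ser2 B)) (u ^ (branch_ramif B div ramif (ser2 B))),
      z * eval_fps (ser (ser3 B)) (u ^ (branch_ramif B div ramif (ser3 B))))"
proof -
  note pow = powr_root_power[OF z]
  show "u ^ branch_ramif B = inverse z"
    using c z branch_ramif_pos[OF B] unfolding u_def power_mult_distrib pow by (simp add: powr_minus)
  have "c ^ (branch_ramif B div m) * z powr (- 1 / of_nat m) = u ^ (branch_ramif B div m)"
    if m: "m dvd branch_ramif B" "m > 0" for m
  proof -
    have "(of_nat (branch_ramif B div m) :: complex) / of_nat (branch_ramif B) = 1 / of_nat m"
      using m branch_ramif_pos[OF B] by (auto elim!: dvdE)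
    then show ?thesis unfolding u_def power_mult_distrib pow by simp
  qed
  then show "leaf_point B c z = (z, z * eval_fps (ser (ser2 B)) (u ^ (branch_ramif B div ramif (ser2 B))),
      z * eval_fps (ser (ser3 B)) (u ^ (branch_ramif B div ramif (ser3 B))))"
    using B by (simp add: leaf_point_def branch_fun_def branch_ok_def branch_ramif_def)
qed

lemma fps_cutoff_eq_poly: "fps_cutoff (Suc N) f = fps_of_poly (\<Sum>i\<le>N. monom (fps_nth f i) i)"
  by (rule fps_ext) (auto simp: coeff_sum less_Suc_eq_le)

lemma eval_fps_cutoff:
  fixes x :: complex
  shows "eval_fps (fps_cutoff (Suc N) f) x = (\<Sum>i\<le>N. fps_nth f i * x ^ i)"
  unfolding fps_cutoff_eq_poly by (simp add: poly_sum poly_monom)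

lemma eval_fps_minus_cutoff:
  fixes x :: complex
  assumes "ereal (norm x) < fps_conv_radius f"
  shows "eval_fps f x - eval_fps (fps_cutoff (Suc N) f) x = x ^ Suc N * eval_fps (fps_shift (Suc N) f) x"
proof -
  have "eval_fps f x = eval_fps (fps_X ^ Suc N * fps_shift (Suc N) f + fps_cutoff (Suc N) f) x"
    by (simp only: fps_shift_cutoff')
  also have "\<dots> = eval_fps (fps_X ^ Suc N * fps_shift (Suc N) f) x + eval_fps (fps_cutoff (Suc N) f) x"
    using assms
    by (intro eval_fps_add less_le_trans[OF _ fps_conv_radius_mult])
      (auto simp: fps_cutoff_eq_poly simp del: power_Suc)
  also have "eval_fps (fps_X ^ Suc N * fps_shift (Suc N) f) x = x ^ Suc N * eval_fps (fps_shift (Suc N) f) x"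
    using assms by (subst eval_fps_mult) (auto simp del: power_Suc)
  finally show ?thesis by simp
qed

text \<open>With z = v ^ M and t = v ^ (M div n), the term of index i is a multiple of v ^ (M - (M
  div \<open>ramif \<phi>\<close>) * i), a power of t by
  \<open>trunc_exponent_exact\<close>.\<close>

lemma trunc_eval:
  assumes \<phi>: "ramif \<phi> > 0" and n: "n > 0" "trunc_denom \<phi> dvd n" "n dvd M" and M: "ramif \<phi> dvd M"
    and v: "v \<noteq> 0"
  shows "v ^ M * eval_fps (ser (trunc_puiseux \<phi>)) (inverse v ^ (M div ramif \<phi>)) =
    poly (trunc_poly n \<phi>) (v ^ (M div n))"
proof -
  have summand: "v ^ M * (fps_nth (ser \<phi>) i * (inverse v ^ (M div ramif \<phi>)) ^ i) =
      fps_nth (ser \<phi>) i * (v ^ (M div n)) ^ (n * (ramif \<phi> - i) div ramif \<phi>)"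
    if i: "i \<le> ramif \<phi>" for i
  proof (cases "fps_nth (ser \<phi>) i = 0")
    case False
    obtain k where k: "M = ramif \<phi> * k" using M by blast
    obtain l where l: "M = n * l" using n(3) by blast
    obtain E where E: "n * (ramif \<phi> - i) = ramif \<phi> * E" using trunc_exponent_exact[OF n(2) i False] by blast
    have "n * (l * E) = n * (k * (ramif \<phi> - i))"
    proof -
      have "n * (l * E) = ramif \<phi> * E * k" using k l by (simp add: mult_ac)
      then show ?thesis using E by (simp add: mult_ac)
    qed
    then have "l * E = k * (ramif \<phi> - i)" using n(1) by simp
    moreover have "k * (ramif \<phi> - i) + k * i = k * (ramif \<phi> - i + i)" by (simp only: distrib_left)
    then have "M = k * (ramif \<phi> - i) + k * i" using i by (simp add: k mult.commute)
    ultimately have "v ^ M * (inverse v ^ k) ^ i = (v ^ l) ^ E"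
      using v by (simp add: power_add power_inverse flip: power_mult)
    then have "v ^ M * (x * (inverse v ^ k) ^ i) = x * (v ^ l) ^ E" for x
      by (metis mult.left_commute)
    moreover have "M div n = l" using n(1) l by simp
    moreover have "M div ramif \<phi> = k" using \<phi> k by simp
    moreover have "n * (ramif \<phi> - i) div ramif \<phi> = E" using \<phi> E by simp
    ultimately show ?thesis by metis
  qed simp
  show ?thesis
    unfolding trunc_puiseux_def poly_trunc_poly
    by (simp add: eval_fps_cutoff sum_distrib_left del: mult_cancel_left) (intro sum.cong refl summand, simp)
qed

lemma leaf_trunc_branch:
  assumes B: "branch_ok B" and z: "z \<noteq> 0" and c: "c ^ branch_ramif B = 1"
  shows "\<exists>t. t ^ branch_degree B = z \<and> leaf_point (trunc_branch B M) c z = trunc_param B t"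
proof -
  let ?B = "trunc_branch B M"
  have same: "branch_ramif ?B = branch_ramif B" "ramif (ser2 ?B) = ramif (ser2 B)" "ramif (ser3 ?B) = ramif (ser3 B)"
    "branch_ok ?B"
    using B by (simp_all add: trunc_branch_def trunc_puiseux_def branch_ramif_def branch_ok_def)
  define u where "u = c * z powr (- 1 / of_nat (branch_ramif B))"
  note leaf = leaf_point_altdef[OF same(4) z, of c, unfolded same, OF c, folded u_def]
  define v where "v = inverse u"
  have v: "v ^ branch_ramif B = z" "v \<noteq> 0" "u = inverse v"
    using leaf(1) z branch_ramif_pos[OF B] by (auto simp: v_def power_inverse power_0_left)
  define n where "n = branch_degree B"
  have dvd: "n dvd branch_ramif B" "trunc_denom (ser2 B) dvd n" "trunc_denom (ser3 B) dvd n"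
    using trunc_denom_dvd[of "ser2 B"] trunc_denom_dvd[of "ser3 B"]
    by (auto simp: n_def branch_degree_def branch_ramif_def intro: dvd_trans)
  have "(v ^ (branch_ramif B div n)) ^ n = z" using dvd(1) v(1) by (simp flip: power_mult)
  moreover have "z * eval_fps (ser (ser2 ?B)) (u ^ (branch_ramif B div ramif (ser2 B))) =
      poly (trunc_poly n (ser2 B)) (v ^ (branch_ramif B div n))"
    using trunc_eval[of "ser2 B" n "branch_ramif B" v] B dvd branch_degree_pos[OF B] v
    by (simp add: branch_ok_def n_def trunc_branch_def branch_ramif_def)
  moreover have "z * eval_fps (ser (ser3 ?B)) (u ^ (branch_ramif B div ramif (ser3 B))) =
      poly (trunc_poly n (ser3 B)) (v ^ (branch_ramif B div n))"
    using trunc_eval[of "ser3 B" n "branch_ramif B" v] B dvd branch_degree_pos[OF B] v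
    by (simp add: branch_ok_def n_def trunc_branch_def branch_ramif_def)
  ultimately show ?thesis
    unfolding leaf(2) by (intro exI[of _ "v ^ (branch_ramif B div n)"]) (simp add: trunc_param_def n_def)
qed

section \<open>Distance between a branch and its truncation\<close>

lemma norm_powr_of_real:
  assumes "z \<noteq> 0" shows "norm (z powr complex_of_real a) = norm z powr a"
  using assms by (simp add: powr_def)

lemma neg_root_tendsto_0:
  assumes "N > 0" shows "((\<lambda>z::complex. z powr (- 1 / of_nat N)) \<longlongrightarrow> 0) at_infinity"
proof -
  have "((\<lambda>z::complex. norm z powr (- 1 / real N)) \<longlongrightarrow> 0) at_infinity"
    using assms by (intro tendsto_neg_powr filterlim_norm_at_top) auto
  moreover have "\<forall>\<^sub>F z::complex in at_infinity. norm z powr (- 1 / real N) = norm (z powr (- 1 / of_nat N))"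
    using eventually_not_equal_at_infinity[of 0]
  proof eventually_elim
    case (elim z)
    then show ?case using norm_powr_of_real[of z "- 1 / real N"] by simp
  qed
  ultimately have "((\<lambda>z::complex. norm (z powr (- 1 / of_nat N))) \<longlongrightarrow> 0) at_infinity"
    by (rule Lim_transform_eventually)
  then show ?thesis by (rule tendsto_norm_zero_cancel)
qed

lemma converges_beyond_radius_pos:
  assumes "converges_beyond \<phi> M" shows "fps_conv_radius (ser \<phi>) > 0"
proof -
  have "norm (complex_of_real (\<bar>M\<bar> + 1)) > M" by simp
  then have "ereal (norm (complex_of_real (\<bar>M\<bar> + 1) powr (- 1 / of_nat (ramif \<phi>)))) < fps_conv_radius (ser \<phi>)"
    using assms unfolding converges_beyond_def by blast
  then show ?thesis by (rule le_less_trans[rotated]) simp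
qed

text \<open>With x = z powr (- 1 / N) the removed tail is z * x ^ (N + 1) * g x for a convergent
  series g. Since x ^ N = 1 / z, only x * g x remains.\<close>

lemma branch_fun_minus_trunc_tendsto_0:
  assumes \<phi>: "ramif \<phi> > 0" and conv: "fps_conv_radius (ser \<phi>) > 0"
  shows "((\<lambda>z. branch_fun \<phi> 1 z - branch_fun (trunc_puiseux \<phi>) 1 z) \<longlongrightarrow> 0) at_infinity"
proof -
  define N where "N = ramif \<phi>"
  define x :: "complex \<Rightarrow> complex" where "x z = z powr (- 1 / of_nat N)" for z
  define g where "g = fps_shift (Suc N) (ser \<phi>)"
  have x: "(x \<longlongrightarrow> 0) at_infinity" unfolding x_def using \<phi> by (intro neg_root_tendsto_0) (simp add: N_def)
  have "isCont (eval_fps g) 0"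
    using conv by (intro DERIV_isCont[OF has_field_derivative_eval_fps]) (simp add: g_def zero_ereal_def)
  then have "((\<lambda>z. eval_fps g (x z)) \<longlongrightarrow> eval_fps g 0) at_infinity"
    using x by (rule isCont_tendsto_compose)
  from tendsto_mult[OF x this] have "((\<lambda>z. x z * eval_fps g (x z)) \<longlongrightarrow> 0) at_infinity" by simp
  moreover obtain \<rho> where \<rho>: "0 < \<rho>" "ereal \<rho> < fps_conv_radius (ser \<phi>)"
    using ereal_dense2[OF conv] by (auto simp: zero_ereal_def)
  have "\<forall>\<^sub>F z in at_infinity. dist (x z) 0 < \<rho>" using x \<rho>(1) by (rule tendstoD)
  then have "\<forall>\<^sub>F z in at_infinity. x z * eval_fps g (x z) = branch_fun \<phi> 1 z - branch_fun (trunc_puiseux \<phi>) 1 z"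
    using eventually_not_equal_at_infinity[of 0]
  proof eventually_elim
    case (elim z)
    have "ereal (norm (x z)) < fps_conv_radius (ser \<phi>)" using elim(1) by (intro less_trans[OF _ \<rho>(2)]) simp
    from eval_fps_minus_cutoff[OF this, of N]
    have "branch_fun \<phi> 1 z - branch_fun (trunc_puiseux \<phi>) 1 z = z * (x z ^ Suc N * eval_fps g (x z))"
      by (simp add: branch_fun_def trunc_puiseux_def x_def N_def g_def flip: right_diff_distrib)
    also have "x z ^ N = inverse z"
      unfolding x_def powr_root_power[OF elim(2)] using elim(2) \<phi> by (simp add: N_def powr_minus)
    then have "z * (x z ^ Suc N * eval_fps g (x z)) = x z * eval_fps g (x z)" using elim(2) by simp
    finally show ?case ..
  qed
  ultimately show ?thesis by (rule Lim_transform_eventually)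
qed

lemma dist_same_fst_le:
  fixes a b :: "'a::real_normed_vector" and c d :: "'b::real_normed_vector"
  shows "dist (z, a, c) (z, b, d) \<le> norm (a - b) + norm (c - d)"
  using sqrt_sum_squares_le_sum_abs[of "dist a b" "dist c d"]
  by (simp add: dist_Pair_Pair) (simp add: dist_norm)

lemma infdist_truncation_tendsto_0:
  assumes B: "branch_ok B" and conv: "fps_conv_radius (ser (ser2 B)) > 0" "fps_conv_radius (ser (ser3 B)) > 0"
    and D: "\<And>z. z \<noteq> 0 \<Longrightarrow> leaf_point (trunc_branch B M) 1 z \<in> D"
  shows "((\<lambda>z. infdist (leaf_point B 1 z) D) \<longlongrightarrow> 0) at_infinity"
proof (rule tendsto_sandwich[OF _ _ tendsto_const])
  let ?d = "\<lambda>\<phi> z. norm (branch_fun \<phi> 1 z - branch_fun (trunc_puiseux \<phi>) 1 z)"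
  show "((\<lambda>z. ?d (ser2 B) z + ?d (ser3 B) z) \<longlongrightarrow> 0) at_infinity"
    using B conv by (intro tendsto_add_zero tendsto_norm_zero branch_fun_minus_trunc_tendsto_0) (auto simp: branch_ok_def)
  show "\<forall>\<^sub>F z in at_infinity. infdist (leaf_point B 1 z) D \<le> ?d (ser2 B) z + ?d (ser3 B) z"
    using eventually_not_equal_at_infinity[of 0]
  proof eventually_elim
    case (elim z)
    have "infdist (leaf_point B 1 z) D \<le> dist (leaf_point B 1 z) (leaf_point (trunc_branch B M) 1 z)"
      by (intro infdist_le D elim)
    also have "\<dots> \<le> ?d (ser2 B) z + ?d (ser3 B) z"
      by (simp add: leaf_point_def trunc_branch_def dist_same_fst_le)
    finally show ?case .
  qed
qed (simp add: infdist_nonneg)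

lemma polyfuns_holomorphic:
  assumes "F \<in> polyfuns X" "\<And>f. f \<in> X \<Longrightarrow> f holomorphic_on S" shows "F holomorphic_on S"
  using assms(1) by induction (auto intro: holomorphic_intros assms(2))

text \<open>
  In the uniformizing coordinate \<open>u = z powr (- 1 / N)\<close> all leaves are restrictions of one holomorphic map on
  a punctured disc, so the equations of a curve pass from one leaf to the others.
\<close>

lemma leaves_in_algebraic:
  assumes V: "algebraic V" and B: "infinity_branch V B" and c: "c ^ branch_ramif B = 1"
  shows "\<forall>\<^sub>F z in at_infinity. leaf_point B c z \<in> V"
proof -
  have ok: "branch_ok B" using B by (auto simp: branch_ok_def infinity_branch_def reduced_def)
  define N where "N = branch_ramif B"
  define k2 k3 where "k2 = N div ramif (ser2 B)" and "k3 = N div ramif (ser3 B)"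
  define f2 f3 where "f2 = ser (ser2 B)" and "f3 = ser (ser3 B)"
  have N: "N > 0" unfolding N_def by (rule branch_ramif_pos[OF ok])
  have k: "k2 > 0" "k3 > 0"
    unfolding k2_def k3_def using ok N by (auto simp: N_def branch_ramif_def branch_ok_def div_greater_zero_iff dvd_imp_le)
  have conv: "0 < fps_conv_radius f2" "0 < fps_conv_radius f3"
    unfolding f2_def f3_def using B by (auto simp: infinity_branch_def intro: converges_beyond_radius_pos)
  obtain \<rho>2 \<rho>3 where \<rho>: "0 < \<rho>2" "ereal \<rho>2 < fps_conv_radius f2" "0 < \<rho>3" "ereal \<rho>3 < fps_conv_radius f3"
    using ereal_dense2[OF conv(1)] ereal_dense2[OF conv(2)] by (auto simp: zero_ereal_def)
  \<comment> \<open>Inside this radius both series converge; the last bound forces |z| >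
    \<open>radius B\<close> for z = 1 / u ^ N and gives r \<le> 1, so positive powers of
    \<open>u\<close> stay in the disc.\<close>
  define r where "r = Min {\<rho>2, \<rho>3, 1 / (radius B + 1)}"
  have rad: "radius B \<ge> 0" using B by (simp add: infinity_branch_def)
  have r: "0 < r" "r \<le> \<rho>2" "r \<le> \<rho>3" "r \<le> 1 / (radius B + 1)" using \<rho> rad by (auto simp: r_def)
  have r1: "r \<le> 1" using r(4) rad by (simp add: order_trans)
  define S :: "complex set" where "S = ball 0 r - {0}"
  have pow_less: "norm (u ^ k) < r" if "u \<in> S" "k > 0" for u :: complex and k
  proof -
    have "norm u ^ k \<le> norm u ^ 1" using that r1 by (intro power_decreasing) (auto simp: S_def)
    then show ?thesis using that by (auto simp: S_def norm_power)
  qed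
  define \<Gamma> where "\<Gamma> u = (inverse (u ^ N), inverse (u ^ N) * eval_fps f2 (u ^ k2), inverse (u ^ N) * eval_fps f3 (u ^ k3))" for u
  have leaf: "leaf_point B c z = \<Gamma> (c * z powr (- 1 / of_nat N))" if "z \<noteq> 0" "c ^ N = 1" for c z
    using leaf_point_altdef[OF ok that(1), of c] that(2)
    by (simp add: \<Gamma>_def N_def k2_def k3_def f2_def f3_def)
  have holo_eval: "(\<lambda>u. eval_fps f (u ^ k)) holomorphic_on S" if "ereal r \<le> fps_conv_radius f" "k > 0" for f k
  proof -
    have "(\<lambda>u. u ^ k) ` S \<subseteq> eball 0 (fps_conv_radius f)"
      using pow_less[OF _ that(2)] by (auto simp: in_eball_iff intro!: less_le_trans[OF _ that(1)])
    then show ?thesis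
      by (intro holomorphic_on_compose_gen[of "\<lambda>u. u ^ k" S "eval_fps f" "eball 0 (fps_conv_radius f)", unfolded comp_def]
          holomorphic_intros) auto
  qed
  have r_conv: "ereal r \<le> fps_conv_radius f2" "ereal r \<le> fps_conv_radius f3"
    using r(2,3) \<rho>(2,4) by (meson ereal_less_eq(3) less_imp_le order_trans)+
  \<comment> \<open>A small positive real \<open>u\<close> belongs to a positive real z on the leaf
    c = 1, where the principal root returns \<open>u\<close>.\<close>
  have real_in: "\<Gamma> (of_real s) \<in> V" if s: "0 < s" "s < r" for s
  proof -
    define z where "z = complex_of_real (inverse (s ^ N))"
    have "z powr (- 1 / of_nat N) = complex_of_real (inverse (s ^ N) powr (- 1 / real N))"
      unfolding z_def using s powr_of_real[of "inverse (s ^ N)" "- 1 / real N"] by simp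
    also have "inverse (s ^ N) = s powr (- real N)" using s by (simp add: powr_minus powr_realpow)
    also have "(s powr (- real N)) powr (- 1 / real N) = s" using s N by (simp add: powr_powr)
    finally have z: "z powr (- 1 / of_nat N) = of_real s" .
    have "s ^ N \<le> s ^ 1" using s r1 N by (intro power_decreasing) auto
    also have "s < 1 / (radius B + 1)" using s r(4) by simp
    finally have "radius B + 1 < inverse (s ^ N)"
      using s rad by (simp add: field_simps)
    then have "norm z > radius B" "z \<noteq> 0" using s rad by (auto simp: z_def norm_inverse norm_power)
    then have "leaf_point B 1 z \<in> V" using B by (auto simp: infinity_branch_def leaf_def)
    then show ?thesis using leaf[OF \<open>z \<noteq> 0\<close>, of 1] z by simp
  qed
  have in_V: "\<Gamma> u \<in> V" if u: "u \<in> S" for u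
  proof (rule algebraic_memI[OF V])
    fix g assume g: "g \<in> vanishing V"
    let ?X = "{\<lambda>u. inverse (u ^ N), \<lambda>u. inverse (u ^ N) * eval_fps f2 (u ^ k2), \<lambda>u. inverse (u ^ N) * eval_fps f3 (u ^ k3)}"
    have "(\<lambda>u. eval3 g (\<Gamma> u)) \<in> polyfuns ?X"
      unfolding \<Gamma>_def by (intro polyfuns_eval3 polyfuns.gen) auto
    then have holo: "(\<lambda>u. eval3 g (\<Gamma> u)) holomorphic_on S"
    proof (rule polyfuns_holomorphic)
      have "(\<lambda>u. inverse (u ^ N)) holomorphic_on S" by (intro holomorphic_intros) (auto simp: S_def)
      then show "f holomorphic_on S" if "f \<in> ?X" for f
        using that holo_eval[OF r_conv(1) k(1)] holo_eval[OF r_conv(2) k(2)]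
        by (auto intro: holomorphic_on_mult)
    qed
    define U where "U = complex_of_real ` {0<..<r}"
    have S: "open S" "connected S"
      unfolding S_def by (auto intro: connected_punctured_ball)
    \<comment> \<open>The map has a pole at 0, so the identity theorem is applied at an accumulation
      point inside the punctured disc.\<close>
    have "complex_of_real (r / 2) islimpt U"
      unfolding islimpt_approachable
    proof (intro allI impI)
      fix e :: real assume e: "e > 0"
      define s where "s = r / 2 + min (e / 2) (r / 4)"
      have "s \<in> {0<..<r}" "s \<noteq> r / 2" "\<bar>s - r / 2\<bar> < e" using e r(1) by (auto simp: s_def min_def)
      moreover from this have "dist (complex_of_real s) (complex_of_real (r / 2)) < e"
        unfolding dist_norm by (metis norm_of_real of_real_diff)
      ultimately show "\<exists>x'\<in>U. x' \<noteq> complex_of_real (r / 2) \<and> dist x' (complex_of_real (r / 2)) < e"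
        unfolding U_def by (intro bexI[of _ "complex_of_real s"]) (auto simp del: of_real_divide)
    qed
    moreover have "complex_of_real (r / 2) \<in> S" "U \<subseteq> S" using r(1) by (auto simp: S_def U_def)
    moreover have "eval3 g (\<Gamma> u) = 0" if "u \<in> U" for u
      using that real_in g by (auto simp: U_def vanishing_def)
    ultimately show "eval3 g (\<Gamma> u) = 0"
      by (intro analytic_continuation[OF holo S _ _ _ _ u, of U "complex_of_real (r / 2)"])
  qed
  have "((\<lambda>z. c * z powr (- 1 / of_nat N)) \<longlongrightarrow> c * 0) at_infinity"
    by (intro tendsto_mult tendsto_const neg_root_tendsto_0 N)
  then have "\<forall>\<^sub>F z in at_infinity. dist (c * z powr (- 1 / of_nat N)) (c * 0) < r" using r(1) by (rule tendstoD)
  then show ?thesis using eventually_not_equal_at_infinity[of 0]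
  proof eventually_elim
    case (elim z)
    have "c \<noteq> 0" using c N by (auto simp: N_def power_0_left)
    then have "c * z powr (- 1 / of_nat N) \<in> S" using elim by (auto simp: S_def dist_norm)
    then show ?case using in_V leaf[OF elim(2)] c by (simp add: N_def)
  qed
qed

section \<open>Perfectness and the asymptote\<close>

context param_curve
begin

text \<open>The branch is arbitrary and not assumed to come from \<open>Q\<close>: each of its
  leaves eventually lies on the curve and so gives points Q (t j) with t j ^ n = z j, to which
  \<open>degree_approaching_ge\<close> applies.\<close>

lemma perfect_range_Q: "perfect (range Q)"
  unfolding perfect_def
proof (intro conjI exI[of _ n] allI impI has_degree_range_Q)
  show "space_curve (range Q)"
    unfolding space_curve_def using irreducible_curve_range_Q by (intro exI[of _ "{range Q}"]) auto
  fix B D e assume *: "infinity_branch (range Q) B \<and> space_curve D \<and> has_degree D e \<and> e < n"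
  show "\<not> approaches D (range Q) B"
  proof
    assume "approaches D (range Q) B"
    then obtain c where c: "c ^ branch_ramif B = 1"
      and lim: "((\<lambda>z. infdist (leaf_point B c z) D) \<longlongrightarrow> 0) at_infinity"
      by (auto simp: approaches_def)
    obtain M where M: "\<And>z. M \<le> norm z \<Longrightarrow> leaf_point B c z \<in> range Q"
      using leaves_in_algebraic[OF algebraic_range_Q _ c] * unfolding eventually_at_infinity by blast
    define z where "z j = complex_of_real (real j + \<bar>M\<bar>)" for j :: nat
    have nz: "norm (z j) = real j + \<bar>M\<bar>" for j by (simp add: z_def flip: of_real_add)
    have "leaf_point B c (z j) \<in> range Q" for j by (rule M) (simp add: nz)
    then have "\<exists>t. leaf_point B c (z j) = Q t" for j by (simp add: image_iff)
    then obtain t where t: "\<And>j. leaf_point B c (z j) = Q (t j)" by metis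
    have "t j ^ n = z j" for j using t[of j] by (simp add: leaf_point_def Q_def)
    then have norm_t: "norm (t j) ^ n = real j + \<bar>M\<bar>" for j using nz by (metis norm_power)
    have "filterlim (\<lambda>j. norm (t j)) at_top sequentially"
      unfolding filterlim_at_top
    proof
      fix Z :: real
      have "\<forall>\<^sub>F j in sequentially. real j \<ge> (max Z 0) ^ n"
        using filterlim_real_sequentially unfolding filterlim_at_top by blast
      then show "\<forall>\<^sub>F j in sequentially. Z \<le> norm (t j)"
      proof eventually_elim
        case (elim j)
        then have "(max Z 0) ^ n \<le> norm (t j) ^ n" by (simp add: norm_t)
        then have "max Z 0 \<le> norm (t j)" using n by (simp add: power_mono_iff)
        then show ?case by simp
      qed
    qed
    then have t_inf: "filterlim t at_infinity sequentially"
      by (simp add: filterlim_at_infinity_conv_norm_at_top)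
    have "filterlim (\<lambda>j. norm (z j)) at_top sequentially"
      by (rule filterlim_at_top_mono[OF filterlim_real_sequentially]) (simp add: nz)
    then have "filterlim z at_infinity sequentially" by (simp add: filterlim_at_infinity_conv_norm_at_top)
    from filterlim_compose[OF lim this] have "(\<lambda>j. infdist (Q (t j)) D) \<longlonglongrightarrow> 0" by (simp add: t)
    then show False using degree_approaching_ge[OF _ _ t_inf] * by fastforce
  qed
qed

end

theorem theorem4p10:
  fixes C :: "point3 set" and f1 f2 :: "real poly3" and B :: branch
    and m2 m3 :: complex and M' :: real
  assumes "irreducible_curve C" and "\<not> planar C" and "real_curve C"
    and "C = zero_set {complex_poly3 f1, complex_poly3 f2}"
    and "\<forall>(x, y, z, w) \<in> points_at_infinity C. x \<noteq> 0"
    and "infinity_branch C B" and "infinity_point B = (1, m2, m3, 0)"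
    and "M' \<ge> 0"
  shows "(\<exists>!D. irreducible_curve D \<and> branch_set (trunc_branch B M') \<subseteq> D) \<and>
    (\<forall>D. irreducible_curve D \<and> branch_set (trunc_branch B M') \<subseteq> D \<longrightarrow>
       parametrized_by D (trunc_param B) \<and> g_asymptote D C B)"
proof -
  have ok: "branch_ok B" using assms(6) by (auto simp: branch_ok_def infinity_branch_def reduced_def)
  interpret param_curve "branch_degree B" "trunc_poly (branch_degree B) (ser2 B)" "trunc_poly (branch_degree B) (ser3 B)"
    by (rule param_curve_trunc[OF ok])
  have Q: "Q = trunc_param B" by (simp add: Q_def trunc_param_def fun_eq_iff)
  have same: "branch_ramif (trunc_branch B M') = branch_ramif B" "radius (trunc_branch B M') = M'"
    by (simp_all add: trunc_branch_def trunc_puiseux_def branch_ramif_def)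
  have leaf: "\<exists>t. t ^ branch_degree B = z \<and> leaf_point (trunc_branch B M') c z = Q t"
    if "z \<noteq> 0" "c ^ branch_ramif B = 1" for c z
    unfolding Q using leaf_trunc_branch[OF ok that] .
  have sub: "branch_set (trunc_branch B M') \<subseteq> range Q"
  proof
    fix p assume "p \<in> branch_set (trunc_branch B M')"
    then obtain c z where cz: "c ^ branch_ramif B = 1" "norm z > M'" "p = leaf_point (trunc_branch B M') c z"
      by (auto simp: branch_set_def leaf_def same)
    then have "z \<noteq> 0" using assms(8) by auto
    then show "p \<in> range Q" using leaf[OF _ cz(1)] cz(3) by blast
  qed
  \<comment> \<open>The n-th powers of elements of \<open>T\<close> cover all z with |z| > M', so
    \<open>T\<close> is infinite; this gives uniqueness of the curve through the truncated
    branch.\<close>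
  define T where "T = {t. Q t \<in> branch_set (trunc_branch B M')}"
  have "{z::complex. norm z > M'} \<subseteq> (\<lambda>t. t ^ branch_degree B) ` T"
  proof
    fix z :: complex assume "z \<in> {z. norm z > M'}"
    then have z: "norm z > M'" "z \<noteq> 0" using assms(8) by auto
    obtain t where t: "t ^ branch_degree B = z" "leaf_point (trunc_branch B M') 1 z = Q t"
      using leaf[OF z(2), of 1] by auto
    have "leaf_point (trunc_branch B M') 1 z \<in> branch_set (trunc_branch B M')"
      unfolding branch_set_def leaf_def same using z(1) by (intro UN_I[of 1]) auto
    then show "z \<in> (\<lambda>t. t ^ branch_degree B) ` T" using t by (auto simp: T_def)
  qed
  moreover have "infinite {z::complex. norm z > M'}"
  proof
    assume "finite {z::complex. norm z > M'}"
    from eventually_notin_finite_at_infinity[OF this]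
    obtain b where "\<And>z::complex. norm z \<ge> b \<Longrightarrow> \<not> norm z > M'" unfolding eventually_at_infinity by blast
    moreover have "norm (complex_of_real (\<bar>b\<bar> + \<bar>M'\<bar> + 1)) = \<bar>b\<bar> + \<bar>M'\<bar> + 1"
      unfolding norm_of_real by simp
    ultimately show False by (smt (verit))
  qed
  ultimately have T: "infinite T" by (meson finite_imageI finite_subset)
  have unique: "D = range Q" if "irreducible_curve D" "branch_set (trunc_branch B M') \<subseteq> D" for D
    by (rule irreducible_curve_unique[OF that(1) T]) (use that(2) in \<open>auto simp: T_def\<close>)
  have "zariski_closure (range Q) = range Q"
    using zariski_closure_minimal[OF algebraic_range_Q subset_refl] subset_zariski_closure by blast
  then have "parametrized_by (range Q) (trunc_param B)" by (simp add: parametrized_by_def Q)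
  moreover have "approaches (range Q) C B"
    unfolding approaches_def
  proof (intro conjI assms exI[of _ 1])
    show "((\<lambda>z. infdist (leaf_point B 1 z) (range Q)) \<longlongrightarrow> 0) at_infinity"
    proof (rule infdist_truncation_tendsto_0[OF ok])
      show "fps_conv_radius (ser (ser2 B)) > 0" "fps_conv_radius (ser (ser3 B)) > 0"
        using assms(6) by (auto simp: infinity_branch_def intro: converges_beyond_radius_pos)
      show "leaf_point (trunc_branch B M') 1 z \<in> range Q" if "z \<noteq> 0" for z
        using leaf[OF that, of 1] by auto
    qed
  qed simp
  ultimately show ?thesis
    using unique irreducible_curve_range_Q sub perfect_range_Q unfolding g_asymptote_def by metis
qed

end
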